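(* Fix an integer $d>1$ and $0<p\le\frac1d$. Let $X^{(1)}$ be the Markov chain on $\mathbb E^{(1)}=\{1,\ldots,d\}$ with initial distribution $\nu^{(1)}=(1,0,\ldots,0)$ and transitions $$\mathbf P^{(1)}(k,s)=\begin{cases} 1-\frac12(d-1)p & k=s=1,\\[1mm] \frac12(d-1)p & k=1,\ s=2,\\[1mm] \frac{d+1}{k(k+1)}\,p & 1<k<d,\ s<k,\\[1mm] 1-\left(\frac{d-k}{k+1}+\frac{(d-k+1)(k-1)}{k}\right)p & 1<k<d,\ s=k,\\[1mm] (d-k)p\,\frac{k}{k+1} & 1<k<d,\ s=k+1,\\[1mm] \frac pd & k=d,\ s\le d-1,\\[1mm] \frac pd+1-p & k=d,\ s=d, \end{cases}$$ all other entries being $0$. Let $X^{(2)}$ be the Markov chain on $\mathbb E^{(2)}=\{0,1\}^d$ with initial distribution $\nu^{(2)}((0,\ldots,0))=\nu^{(2)}((1,0,\ldots,0))=\frac12$ and transitions $$\mathbf P^{(2)}(\mathbf i,\mathbf i')=\begin{cases}\frac12p & \text{if } \mathbf i'=\mathbf i\pm\mathbf s_k \text{ for some } k\in\{1,\ldots,d\},\\ 1-\frac12dp & \text{if } \mathbf i'=\mathbf i,\end{cases}$$ all other entries being $0$. Then the fastest strong stationary times $T^{(1)}$ and $T^{(2)}$ of the two chains have the same distribution: $$T^{(1)}\stackrel{(d)}{=}T^{(2)}\stackrel{(d)}{=}\sum_{k=1}^{d-1}X_k,\qquad X_k\sim Geo(k\cdot p)\ \text{independent}.$$ Both chains have the uniform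 stationary distribution on their respective state spaces.
   Context: $\mathbf s_k=(0,\ldots,0,1,0,\ldots,0)$ with $1$ at position $k$. $Geo(q)$ is the geometric distribution on $\{1,2,\ldots\}$, $P(X=n)=q(1-q)^{n-1}$. $\stackrel{(d)}{=}$ means equality in distribution. Separation: $sep(\nu\mathbf P^k,\pi)=\max_{e}\left(1-\nu\mathbf P^k(e)/\pi(e)\right)$. A strong stationary time for a chain $X$ with stationary distribution $\pi$ is a random time $T$ such that $X_T$ has distribution $\pi$ and $T$ is independent of $X_T$; the fastest strong stationary time is the stochastically smallest one, and its law is determined by $P(T>k)=sep(\nu\mathbf P^k,\pi)$ for all $k\ge0$. *)

theory Defs
  imports "HOL-Probability.Probability"
begin

section \<open>Markov chains and strong stationary times\<close>

definition stationary_distribution ::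
  "'e set \<Rightarrow> ('e \<Rightarrow> 'e \<Rightarrow> real) \<Rightarrow> ('e \<Rightarrow> real) \<Rightarrow> bool"
where
  "stationary_distribution E P \<pi> \<longleftrightarrow>
     (\<forall>x\<in>E. 0 \<le> \<pi> x) \<and> (\<Sum>x\<in>E. \<pi> x) = 1 \<and> (\<forall>y\<in>E. (\<Sum>x\<in>E. \<pi> x * P x y) = \<pi> y)"

definition uniform_distribution :: "'e set \<Rightarrow> 'e \<Rightarrow> real" where
  "uniform_distribution E = (\<lambda>_. 1 / real (card E))"

text \<open>The Markov property is required with respect to a filtration \<open>F\<close>, which may be larger
  than the one generated by \<open>X\<close>. This is what allows additional randomization in the stopping
  times below.\<close>

definition markov_chain ::
  "'e set \<Rightarrow> ('e \<Rightarrow> real) \<Rightarrow> ('e \<Rightarrow> 'e \<Rightarrow> real) \<Rightarrow>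
     'w measure \<Rightarrow> (nat \<Rightarrow> 'w measure) \<Rightarrow> (nat \<Rightarrow> 'w \<Rightarrow> 'e) \<Rightarrow> bool"
where
  "markov_chain E \<nu> P M F X \<longleftrightarrow>
     prob_space M \<and> filtration (space M) F \<and> (\<forall>n. subalgebra M (F n)) \<and>
     (\<forall>n. X n \<in> measurable (F n) (count_space E)) \<and>
     (\<forall>x\<in>E. measure M {w \<in> space M. X 0 w = x} = \<nu> x) \<and>
     (\<forall>n. \<forall>A\<in>sets (F n). \<forall>x\<in>E. \<forall>y\<in>E.
        measure M {w \<in> A. X n w = x \<and> X (Suc n) w = y} = measure M {w \<in> A. X n w = x} * P x y)"

text \<open>A strong stationary time is a (randomized) stopping time: it must not anticipate the future
  of the chain. For arbitrary random times the formula \<open>P(T > k) = sep(\<nu> P\<^sup>k, \<pi>)\<close> for the fastest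
  strong stationary time would fail.\<close>

definition strong_stationary_time ::
  "'e set \<Rightarrow> ('e \<Rightarrow> real) \<Rightarrow> ('e \<Rightarrow> 'e \<Rightarrow> real) \<Rightarrow> ('e \<Rightarrow> real) \<Rightarrow>
     'w measure \<Rightarrow> (nat \<Rightarrow> 'w measure) \<Rightarrow> (nat \<Rightarrow> 'w \<Rightarrow> 'e) \<Rightarrow> ('w \<Rightarrow> nat) \<Rightarrow> bool"
where
  "strong_stationary_time E \<nu> P \<pi> M F X T \<longleftrightarrow>
     stationary_distribution E P \<pi> \<and> markov_chain E \<nu> P M F X \<and> stopping_time F T \<and>
     (\<forall>x\<in>E. measure M {w \<in> space M. X (T w) w = x} = \<pi> x) \<and>
     (\<forall>A. \<forall>B\<subseteq>E. measure M {w \<in> space M. T w \<in> A \<and> X (T w) w \<in> B} =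
        measure M {w \<in> space M. T w \<in> A} * measure M {w \<in> space M. X (T w) w \<in> B})"

text \<open>The competitors \<open>T'\<close> live on arbitrary probability measures on the space of pairs
  (trajectory, time). By \<open>strong_stationary_time_canonical\<close> below, the law of any strong
  stationary time on any space is realized there, so \<open>T\<close> is in fact compared with all strong
  stationary times for the chain with data \<open>(E, \<nu>, P)\<close>; see
  \<open>fastest_strong_stationary_time_le\<close>.\<close>

definition fastest_strong_stationary_time ::
  "'e set \<Rightarrow> ('e \<Rightarrow> real) \<Rightarrow> ('e \<Rightarrow> 'e \<Rightarrow> real) \<Rightarrow> ('e \<Rightarrow> real) \<Rightarrow>
     'w measure \<Rightarrow> (nat \<Rightarrow> 'w measure) \<Rightarrow> (nat \<Rightarrow> 'w \<Rightarrow> 'e) \<Rightarrow> ('w \<Rightarrow> nat) \<Rightarrow> bool"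
where
  "fastest_strong_stationary_time E \<nu> P \<pi> M F X T \<longleftrightarrow>
     strong_stationary_time E \<nu> P \<pi> M F X T \<and>
     (\<forall>(M' :: ((nat \<Rightarrow> 'e) \<times> nat) measure) F' X' T'.
        strong_stationary_time E \<nu> P \<pi> M' F' X' T' \<longrightarrow>
        (\<forall>k. measure M {w \<in> space M. T w > k} \<le> measure M' {w \<in> space M'. T' w > k}))"

lemma strong_stationary_time_transfer:
  fixes M :: "'w measure" and S :: "'v measure"
  assumes sst: "strong_stationary_time E \<nu> P \<pi> M F (\<lambda>n w. X n (\<phi> w)) (\<lambda>w. T (\<phi> w))"
    and \<phi>: "\<phi> \<in> measurable M S"
    and X: "\<And>n. X n \<in> measurable S (count_space E)"
    and T: "T \<in> measurable S (count_space UNIV)"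
  shows "\<exists>G. strong_stationary_time E \<nu> P \<pi> (distr M S \<phi>) G X T"
proof -
  have st: "stationary_distribution E P \<pi>"
    and mc: "markov_chain E \<nu> P M F (\<lambda>n w. X n (\<phi> w))"
    and stop: "stopping_time F (\<lambda>w. T (\<phi> w))"
    and law: "\<And>x. x \<in> E \<Longrightarrow> measure M {w \<in> space M. X (T (\<phi> w)) (\<phi> w) = x} = \<pi> x"
    and ind: "\<And>A B. B \<subseteq> E \<Longrightarrow>
      measure M {w \<in> space M. T (\<phi> w) \<in> A \<and> X (T (\<phi> w)) (\<phi> w) \<in> B} =
      measure M {w \<in> space M. T (\<phi> w) \<in> A} * measure M {w \<in> space M. X (T (\<phi> w)) (\<phi> w) \<in> B}"
    using sst unfolding strong_stationary_time_def by blast+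
  have ps: "prob_space M" and fil: "filtration (space M) F" and sub: "\<And>n. subalgebra M (F n)"
    and XF: "\<And>n. (\<lambda>w. X n (\<phi> w)) \<in> measurable (F n) (count_space E)"
    and init: "\<And>x. x \<in> E \<Longrightarrow> measure M {w \<in> space M. X 0 (\<phi> w) = x} = \<nu> x"
    and mp: "\<And>n A x y. A \<in> sets (F n) \<Longrightarrow> x \<in> E \<Longrightarrow> y \<in> E \<Longrightarrow>
        measure M {w \<in> A. X n (\<phi> w) = x \<and> X (Suc n) (\<phi> w) = y} =
        measure M {w \<in> A. X n (\<phi> w) = x} * P x y"
    using mc unfolding markov_chain_def by blast+
  interpret M: prob_space M by fact
  interpret D: prob_space "distr M S \<phi>" by (rule M.prob_space_distr[OF \<phi>])
  have spF: "space (F n) = space M" for n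
    using sub[of n] by (simp add: subalgebra_def)
  define C where "C n = {B \<in> sets S. \<phi> -` B \<inter> space M \<in> sets (F n)}" for n
  define G where "G n = sigma (space S) (C n)" for n
  have saC: "sigma_algebra (space S) (C n)" for n
    unfolding sigma_algebra_iff2
  proof (intro conjI ballI allI impI)
    show "C n \<subseteq> Pow (space S)" using sets.sets_into_space by (auto simp: C_def)
    show "{} \<in> C n" by (auto simp: C_def)
  next
    fix s assume s: "s \<in> C n"
    have "\<phi> -` (space S - s) \<inter> space M = space (F n) - (\<phi> -` s \<inter> space M)"
      using measurable_space[OF \<phi>] by (auto simp: spF)
    then show "space S - s \<in> C n" using s by (auto simp: C_def)
  next
    fix A :: "nat \<Rightarrow> _" assume A: "range A \<subseteq> C n"
    have "\<phi> -` (\<Union>i. A i) \<inter> space M = (\<Union>i. \<phi> -` A i \<inter> space M)" by auto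
    moreover have "A i \<in> sets S" "\<phi> -` A i \<inter> space M \<in> sets (F n)" for i
      using A by (auto simp: C_def)
    then have "(\<Union>i. A i) \<in> sets S" "(\<Union>i. \<phi> -` A i \<inter> space M) \<in> sets (F n)"
      by (intro sets.countable_UN; blast)+
    ultimately show "(\<Union>i. A i) \<in> C n" unfolding C_def by simp
  qed
  have setsG: "sets (G n) = C n" for n
    unfolding G_def by (rule sigma_algebra.sets_measure_of_eq[OF saC])
  have spG: "space (G n) = space S" for n
    unfolding G_def by (rule space_measure_of) (auto simp: C_def dest: sets.sets_into_space)
  have m: "measure (distr M S \<phi>) {w \<in> B. Q w} = measure M {w \<in> \<phi> -` B \<inter> space M. Q (\<phi> w)}"
    if "{w \<in> B. Q w} \<in> sets S" for B Q
    using that by (subst measure_distr[OF \<phi>]) (auto intro!: arg_cong[where f="measure M"])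
  have Xset: "{w \<in> B. X n w = x} \<in> sets S" if "B \<in> sets S" "x \<in> E" for B n x
  proof -
    have "{w \<in> B. X n w = x} = B \<inter> (X n -` {x} \<inter> space S)"
      using sets.sets_into_space[OF that(1)] by auto
    then show ?thesis using measurable_sets[OF X, of "{x}" n] that by auto
  qed
  have XT: "(\<lambda>w. X (T w) w) \<in> measurable S (count_space E)"
    by (rule measurable_compose_countable[OF X T])
  have XTset: "{w \<in> space S. X (T w) w = x} \<in> sets S" if "x \<in> E" for x
  proof -
    have "{w \<in> space S. X (T w) w = x} = (\<lambda>w. X (T w) w) -` {x} \<inter> space S" by auto
    then show ?thesis using measurable_sets[OF XT, of "{x}"] that by auto
  qed
  have sp: "\<phi> -` space S \<inter> space M = space M" using measurable_space[OF \<phi>] by auto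
  have "markov_chain E \<nu> P (distr M S \<phi>) G X"
    unfolding markov_chain_def
  proof (intro conjI allI ballI)
    show "prob_space (distr M S \<phi>)" by (rule D.prob_space_axioms)
    show "filtration (space (distr M S \<phi>)) G"
      by standard (use filtration.sets_F_mono[OF fil] in \<open>auto simp: spG setsG C_def\<close>)
    show "subalgebra (distr M S \<phi>) (G n)" for n
      by (auto simp: subalgebra_def spG setsG C_def)
    show "X n \<in> measurable (G n) (count_space E)" for n
    proof (rule measurableI)
      show "X n w \<in> space (count_space E)" if "w \<in> space (G n)" for w
        using measurable_space[OF X] that by (auto simp: spG)
      fix A assume A: "A \<in> sets (count_space E)"
      have "\<phi> -` (X n -` A \<inter> space S) \<inter> space M = (\<lambda>w. X n (\<phi> w)) -` A \<inter> space (F n)"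
        using measurable_space[OF \<phi>] by (auto simp: spF)
      then show "X n -` A \<inter> space (G n) \<in> sets (G n)"
        using measurable_sets[OF X A] measurable_sets[OF XF A] by (auto simp: spG setsG C_def)
    qed
    show "measure (distr M S \<phi>) {w \<in> space (distr M S \<phi>). X 0 w = x} = \<nu> x" if "x \<in> E" for x
      using m[OF Xset[OF sets.top that]] init[OF that] sp by simp
    fix n A x y assume A: "A \<in> sets (G n)" and x: "x \<in> E" and y: "y \<in> E"
    have AS: "A \<in> sets S" and AF: "\<phi> -` A \<inter> space M \<in> sets (F n)"
      using A by (auto simp: setsG C_def)
    have 1: "{w \<in> A. X n w = x \<and> X (Suc n) w = y} \<in> sets S"
      using Xset[OF Xset[OF AS x] y] by (simp add: conj_assoc)
    show "measure (distr M S \<phi>) {w \<in> A. X n w = x \<and> X (Suc n) w = y} =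
          measure (distr M S \<phi>) {w \<in> A. X n w = x} * P x y"
      unfolding m[OF 1] m[OF Xset[OF AS x]] by (rule mp[OF AF x y])
  qed
  moreover have "stopping_time G T"
  proof
    fix n
    have 1: "{w \<in> space S. T w \<le> n} \<in> sets S"
    proof -
      have "{w \<in> space S. T w \<le> n} = T -` {..n} \<inter> space S" by auto
      then show ?thesis using measurable_sets[OF T, of "{..n}"] by auto
    qed
    have "{w \<in> space (F n). T (\<phi> w) \<le> n} \<in> sets (F n)"
      using stopping_timeD[OF stop, of n] by (simp add: pred_def)
    moreover have "\<phi> -` {w \<in> space S. T w \<le> n} \<inter> space M = {w \<in> space (F n). T (\<phi> w) \<le> n}"
      using measurable_space[OF \<phi>] by (auto simp: spF)
    ultimately show "Measurable.pred (G n) (\<lambda>w. T w \<le> n)"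
      using 1 by (simp add: pred_def spG setsG C_def)
  qed
  moreover have "measure (distr M S \<phi>) {w \<in> space (distr M S \<phi>). X (T w) w = x} = \<pi> x"
    if "x \<in> E" for x
    using m[OF XTset[OF that]] law[OF that] sp by simp
  moreover have "measure (distr M S \<phi>) {w \<in> space (distr M S \<phi>). T w \<in> A \<and> X (T w) w \<in> B} =
      measure (distr M S \<phi>) {w \<in> space (distr M S \<phi>). T w \<in> A} *
      measure (distr M S \<phi>) {w \<in> space (distr M S \<phi>). X (T w) w \<in> B}" if B: "B \<subseteq> E" for A B
  proof -
    have 1: "{w \<in> space S. T w \<in> A} \<in> sets S"
      using measurable_sets[OF T, of A] by (simp add: vimage_def Int_def conj_commute)
    have 2: "{w \<in> space S. X (T w) w \<in> B} \<in> sets S"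
      using measurable_sets[OF XT, of B] B by (simp add: vimage_def Int_def conj_commute)
    have 3: "{w \<in> space S. T w \<in> A \<and> X (T w) w \<in> B} \<in> sets S"
    proof -
      have "{w \<in> space S. T w \<in> A \<and> X (T w) w \<in> B} =
          {w \<in> space S. T w \<in> A} \<inter> {w \<in> space S. X (T w) w \<in> B}" by auto
      then show ?thesis using 1 2 by auto
    qed
    show ?thesis
      unfolding space_distr m[OF 1] m[OF 2] m[OF 3] sp by (rule ind[OF B])
  qed
  ultimately show ?thesis using st by (auto simp: strong_stationary_time_def)
qed

lemma strong_stationary_time_measurable:
  assumes "strong_stationary_time E \<nu> P \<pi> M F X T"
  shows "T \<in> measurable M (count_space UNIV)"
proof -
  have "T \<in> borel_measurable M"
    by (rule measurable_stopping_time[of F])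
       (use assms in \<open>auto simp: subalgebra_def strong_stationary_time_def markov_chain_def\<close>)
  then show ?thesis
    using measurable_cong_sets[OF refl sets_borel_eq_count_space] by blast
qed

lemma strong_stationary_time_canonical:
  fixes M :: "'w measure" and X :: "nat \<Rightarrow> 'w \<Rightarrow> 'e"
  assumes sst: "strong_stationary_time E \<nu> P \<pi> M F X T"
  shows "\<exists>(M' :: ((nat \<Rightarrow> 'e) \<times> nat) measure) F' X' T'.
    strong_stationary_time E \<nu> P \<pi> M' F' X' T' \<and>
    distr M' (count_space UNIV) T' = distr M (count_space UNIV) T"
proof -
  let ?S = "(PiM UNIV (\<lambda>_::nat. count_space E)) \<Otimes>\<^sub>M (count_space UNIV :: nat measure)"
  let ?\<phi> = "\<lambda>w. ((\<lambda>n. X n w), T w)"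
  have sub: "subalgebra M (F n)" and XF: "X n \<in> measurable (F n) (count_space E)" for n
    using sst by (auto simp: strong_stationary_time_def markov_chain_def)
  have XM: "X n \<in> measurable M (count_space E)" for n
    using measurable_from_subalg[OF sub XF] .
  have TM: "T \<in> measurable M (count_space UNIV)"
    by (rule strong_stationary_time_measurable[OF sst])
  have \<phi>: "?\<phi> \<in> measurable M ?S"
  proof (rule measurable_Pair[OF _ TM])
    show "(\<lambda>w n. X n w) \<in> measurable M (PiM UNIV (\<lambda>_::nat. count_space E))"
      by (rule measurable_PiM_single') (use XM measurable_space[OF XM] in \<open>auto simp: space_PiM\<close>)
  qed
  obtain G where "strong_stationary_time E \<nu> P \<pi> (distr M ?S ?\<phi>) G (\<lambda>n v. fst v n) snd"
    using strong_stationary_time_transfer[of E \<nu> P \<pi> M F "\<lambda>n v. fst v n" ?\<phi> snd ?S] sst \<phi>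
    by auto
  moreover have "distr (distr M ?S ?\<phi>) (count_space UNIV) snd = distr M (count_space UNIV) T"
    by (subst distr_distr[OF _ \<phi>]) (auto simp: comp_def)
  ultimately show ?thesis by blast
qed

lemma fastest_strong_stationary_time_le:
  fixes M :: "'w measure" and M' :: "'v measure"
  assumes fast: "fastest_strong_stationary_time E \<nu> P \<pi> M F X T"
    and sst: "strong_stationary_time E \<nu> P \<pi> M' F' X' T'"
  shows "measure M {w \<in> space M. T w > k} \<le> measure M' {w \<in> space M'. T' w > k}"
proof -
  obtain M'' :: "((nat \<Rightarrow> 'a) \<times> nat) measure" and F'' X'' T''
    where 1: "strong_stationary_time E \<nu> P \<pi> M'' F'' X'' T''"
      and 2: "distr M'' (count_space UNIV) T'' = distr M' (count_space UNIV) T'"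
    using strong_stationary_time_canonical[OF sst] by blast
  have tail: "measure N {w \<in> space N. S w > k} = measure (distr N (count_space UNIV) S) {k<..}"
    if "S \<in> measurable N (count_space UNIV)" for N :: "'x measure" and S :: "'x \<Rightarrow> nat"
    using that by (subst measure_distr) (auto intro!: arg_cong[where f="measure N"])
  have "measure M {w \<in> space M. T w > k} \<le> measure M'' {w \<in> space M''. T'' w > k}"
    using fast 1 by (simp add: fastest_strong_stationary_time_def)
  also have "\<dots> = measure M' {w \<in> space M'. T' w > k}"
    using tail[OF strong_stationary_time_measurable[OF 1]]
      tail[OF strong_stationary_time_measurable[OF sst]] 2 by simp
  finally show ?thesis .
qed

section \<open>The two chains\<close>

definition E1 :: "nat \<Rightarrow> nat set" where
  "E1 d = {1..d}"

definition \<nu>1 :: "nat \<Rightarrow> real" where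
  "\<nu>1 k = (if k = 1 then 1 else 0)"

definition P1 :: "nat \<Rightarrow> real \<Rightarrow> nat \<Rightarrow> nat \<Rightarrow> real" where
  "P1 d p k s =
    (if k = 1 \<and> s = 1 then 1 - 1/2 * (real d - 1) * p
     else if k = 1 \<and> s = 2 then 1/2 * (real d - 1) * p
     else if 1 < k \<and> k < d \<and> s < k then (real d + 1) / (real k * (real k + 1)) * p
     else if 1 < k \<and> k < d \<and> s = k then
       1 - ((real d - real k) / (real k + 1) +
            (real d - real k + 1) * (real k - 1) / real k) * p
     else if 1 < k \<and> k < d \<and> s = k + 1 then (real d - real k) * p * (real k / (real k + 1))
     else if k = d \<and> s \<le> d - 1 then p / real d
     else if k = d \<and> s = d then p / real d + 1 - p
     else 0)"

text \<open>\<open>{0,1}\<^sup>d\<close>: functions on the indices \<open>1,\<dots>,d\<close>, extended by \<open>0\<close> to all of \<open>nat\<close>.\<close>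

definition E2 :: "nat \<Rightarrow> (nat \<Rightarrow> int) set" where
  "E2 d = PiE_dflt {1..d} 0 (\<lambda>_. {0, 1})"

definition unit_vec :: "nat \<Rightarrow> nat \<Rightarrow> int" where
  "unit_vec k = (\<lambda>j. if j = k then 1 else 0)"

definition \<nu>2 :: "(nat \<Rightarrow> int) \<Rightarrow> real" where
  "\<nu>2 i = (if i = (\<lambda>_. 0) \<or> i = unit_vec 1 then 1/2 else 0)"

definition P2 :: "nat \<Rightarrow> real \<Rightarrow> (nat \<Rightarrow> int) \<Rightarrow> (nat \<Rightarrow> int) \<Rightarrow> real" where
  "P2 d p i i' =
    (if \<exists>k\<in>{1..d}. i' = (\<lambda>j. i j + unit_vec k j) \<or> i' = (\<lambda>j. i j - unit_vec k j) then 1/2 * p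
     else if i' = i then 1 - 1/2 * real d * p
     else 0)"

text \<open>The geometric distribution on \<open>{1, 2, \<dots>}\<close>; the library's \<open>geometric_pmf\<close> starts at \<open>0\<close>.\<close>

definition Geo :: "real \<Rightarrow> nat pmf" where
  "Geo q = map_pmf Suc (geometric_pmf q)"

lemma pmf_Geo:
  assumes "0 < q" "q \<le> 1" "n \<ge> 1"
  shows "pmf (Geo q) n = q * (1 - q) ^ (n - 1)"
proof -
  obtain m where "n = Suc m" using assms(3) by (cases n) auto
  then show ?thesis
    using assms pmf_map_inj'[of Suc "geometric_pmf q" m] by (simp add: Geo_def)
qed

end

theory Submission
  imports Defs
begin

text \<open>
  Both chains carry a family of distributions that one step mixes with larger members of the same
  family, in the manner of the strong stationary duality of Diaconis and Fill. For the chain on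
  \<open>{1,\<dots>,d}\<close> let \<open>u\<^sub>m\<close> be uniform on \<open>{1,\<dots>,m}\<close>. A computation of column sums gives
  \<open>u\<^sub>m P = (d - m) p u\<^bsub>m+1\<^esub> + (1 - (d - m) p) u\<^sub>m\<close>. The walk on the cube refreshes each coordinate with
  probability \<open>p\<close>, giving it a fair random value. If \<open>u\<^sub>S\<close> is uniform on the points that vanish
  outside \<open>S\<close>, then refreshing \<open>k \<notin> S\<close> turns \<open>u\<^sub>S\<close> into the distribution of \<open>S \<union> {k}\<close>, so
  \<open>u\<^sub>S P = \<Sum>\<^bsub>k\<notin>S\<^esub> p u\<^bsub>S\<union>{k}\<^esub> + (1 - (d - |S|) p) u\<^sub>S\<close>. Call \<open>d - m\<close> and \<open>d - |S|\<close> the rank: in both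
  cases rank \<open>r\<close> drops to \<open>r - 1\<close> with probability \<open>r p\<close>, rank \<open>0\<close> is the uniform distribution,
  and the initial distribution has rank \<open>d - 1\<close> (\<open>u\<^sub>1\<close> and \<open>u\<^bsub>{1}\<^esub>\<close>). The time to reach rank \<open>0\<close> is
  therefore a sum of independent geometric variables with parameters \<open>(d-1)p, \<dots>, p\<close>. Its
  distribution function \<open>a\<close> is \<open>geo_sum_cdf\<close>, characterised by conditioning on the first step.

  After \<open>n\<close> steps the chain has law at least \<open>a(n) \<pi>\<close> pointwise, and exactly \<open>a(n) \<pi>\<close> at a state
  \<open>z\<close> that no member of positive rank charges: \<open>z = d\<close> for the first chain and the all-ones vector
  for the second (lemmas \<open>evolve_pow_ge\<close>, \<open>evolve_pow_eq\<close>). So \<open>1 - a(n)\<close> is the separation.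

  Separation then determines the fastest strong stationary time. On the one hand a strong
  stationary time \<open>T\<close> satisfies \<open>P(T \<le> n, X\<^sub>n = y) = P(T \<le> n) \<pi>(y)\<close>, because after \<open>T\<close> the chain
  stays stationary; at \<open>y = z\<close> this gives \<open>P(T \<le> n) \<le> a(n)\<close> (lemma \<open>strong_stationary_time_cdf_le\<close>).
  On the other hand, a chain whose law dominates \<open>a(n) \<pi>\<close> can be stopped at rate exactly
  \<open>a(n) - a(n - 1)\<close> by marking each visited state with a suitable probability, as in the
  construction of Aldous and Diaconis (lemma \<open>exists_strong_stationary_time\<close>). Hence fastest times
  exist, and each has distribution function \<open>a\<close>, on whatever space it lives.
\<close>

section \<open>Lower bounds on strong stationary times\<close>

text \<open>The row vector \<open>u P\<close>, so that \<open>(evolve E P ^^ n) \<nu>\<close> is \<open>\<nu> P\<^sup>n\<close>. Its values outside \<open>E\<close> carry no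
  meaning.\<close>

definition evolve :: "'e set \<Rightarrow> ('e \<Rightarrow> 'e \<Rightarrow> real) \<Rightarrow> ('e \<Rightarrow> real) \<Rightarrow> 'e \<Rightarrow> real" where
  "evolve E P u = (\<lambda>y. \<Sum>x\<in>E. u x * P x y)"

lemma markov_chain_event_sets:
  assumes mc: "markov_chain E \<nu> P M F X" and A: "A \<in> sets (F n)"
  shows "{w \<in> A. X n w \<in> B} \<in> sets (F n)"
proof -
  have X: "X n \<in> measurable (F n) (count_space E)" using mc by (auto simp: markov_chain_def)
  have "{w \<in> A. X n w \<in> B} = A \<inter> (X n -` (B \<inter> E) \<inter> space (F n))"
    using sets.sets_into_space[OF A] measurable_space[OF X] by auto
  then show ?thesis using A measurable_sets[OF X, of "B \<inter> E"] by auto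
qed

lemma markov_chain_sets_mono:
  assumes "markov_chain E \<nu> P M F X" "m \<le> n" "A \<in> sets (F m)"
  shows "A \<in> sets (F n)" "A \<in> sets M"
  using assms filtration.sets_F_mono[of "space M" F m n]
  by (auto simp: markov_chain_def subalgebra_def)

lemma markov_chain_sum_states:
  assumes mc: "markov_chain E \<nu> P M F X" and E: "finite E" and A: "A \<in> sets M"
  shows "measure M A = (\<Sum>x\<in>E. measure M {w \<in> A. X n w = x})"
proof -
  interpret prob_space M using mc by (auto simp: markov_chain_def)
  have sub: "subalgebra M (F n)" and XF: "X n \<in> measurable (F n) (count_space E)"
    using mc by (auto simp: markov_chain_def)
  have X: "X n \<in> measurable M (count_space E)" using measurable_from_subalg[OF sub XF] .
  have s: "{w \<in> A. X n w = x} \<in> sets M" if "x \<in> E" for x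
  proof -
    have "{w \<in> A. X n w = x} = A \<inter> (X n -` {x} \<inter> space M)"
      using sets.sets_into_space[OF A] by auto
    then show ?thesis using measurable_sets[OF X, of "{x}"] that A by auto
  qed
  have "A = (\<Union>x\<in>E. {w \<in> A. X n w = x})"
    using measurable_space[OF X] sets.sets_into_space[OF A] by auto
  then have "measure M A = measure M (\<Union>x\<in>E. {w \<in> A. X n w = x})" by simp
  also have "\<dots> = (\<Sum>x\<in>E. measure M {w \<in> A. X n w = x})"
    by (rule finite_measure_finite_Union) (use E s in \<open>auto simp: disjoint_family_on_def\<close>)
  finally show ?thesis .
qed

lemma markov_chain_step:
  assumes mc: "markov_chain E \<nu> P M F X" and E: "finite E" and A: "A \<in> sets (F n)" and y: "y \<in> E"
  shows "measure M {w \<in> A. X (Suc n) w = y} = evolve E P (\<lambda>x. measure M {w \<in> A. X n w = x}) y"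
proof -
  have "{w \<in> A. X (Suc n) w \<in> {y}} \<in> sets M"
    using markov_chain_event_sets[OF mc, of A "Suc n"] markov_chain_sets_mono[OF mc] A le_SucI
    by blast
  then have "measure M {w \<in> A. X (Suc n) w = y} =
      (\<Sum>x\<in>E. measure M {w \<in> A. X n w = x \<and> X (Suc n) w = y})"
    using markov_chain_sum_states[OF mc E, of "{w \<in> A. X (Suc n) w = y}" n]
    by (simp add: conj_commute conj_left_commute conj_assoc)
  also have "\<dots> = (\<Sum>x\<in>E. measure M {w \<in> A. X n w = x} * P x y)"
    using mc A y by (intro sum.cong) (auto simp: markov_chain_def)
  finally show ?thesis by (simp add: evolve_def)
qed

lemma markov_chain_law:
  assumes mc: "markov_chain E \<nu> P M F X" and E: "finite E" and "y \<in> E"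
  shows "measure M {w \<in> space M. X n w = y} = (evolve E P ^^ n) \<nu> y"
  using \<open>y \<in> E\<close>
proof (induction n arbitrary: y)
  case 0
  then show ?case using mc by (simp add: markov_chain_def)
next
  case (Suc n)
  have "space M = space (F n)" using mc by (auto simp: markov_chain_def subalgebra_def)
  then have "space M \<in> sets (F n)" by (metis sets.top)
  from markov_chain_step[OF mc E this Suc.prems] Suc.IH show ?case
    by (auto simp: evolve_def intro!: sum.cong)
qed

text \<open>At time \<open>T\<close> the chain has law \<open>\<pi>\<close> whatever the value of \<open>T\<close>. The event \<open>T \<le> n\<close> is known at time \<open>n\<close>,
  so the next step is taken with \<open>P\<close>, and \<open>\<pi> P = \<pi>\<close> keeps the conditional law equal to \<open>\<pi>\<close>. The
  induction on \<open>n\<close> adds the event \<open>T = n + 1\<close> at each step.\<close>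

lemma strong_stationary_time_before:
  assumes sst: "strong_stationary_time E \<nu> P \<pi> M F X T" and E: "finite E" and "y \<in> E"
  shows "measure M {w \<in> space M. T w \<le> n \<and> X n w = y} = measure M {w \<in> space M. T w \<le> n} * \<pi> y"
  using \<open>y \<in> E\<close>
proof (induction n arbitrary: y)
  have mc: "markov_chain E \<nu> P M F X" and stop: "stopping_time F T"
    and stat: "stationary_distribution E P \<pi>"
    using sst by (auto simp: strong_stationary_time_def)
  interpret prob_space M using mc by (auto simp: markov_chain_def)
  have at: "measure M {w \<in> space M. T w = n \<and> X n w = x} = measure M {w \<in> space M. T w = n} * \<pi> x"
    if "x \<in> E" for n x
  proof -
    have "measure M {w \<in> space M. T w \<in> {n} \<and> X (T w) w \<in> {x}} =
        measure M {w \<in> space M. T w \<in> {n}} * measure M {w \<in> space M. X (T w) w \<in> {x}}"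
      using sst that unfolding strong_stationary_time_def by blast
    moreover have "measure M {w \<in> space M. X (T w) w = x} = \<pi> x"
      using sst that unfolding strong_stationary_time_def by blast
    ultimately show ?thesis by (simp cong: conj_cong)
  qed
  {
    case 0
    then show ?case using at[of y 0] by simp
  next
    case (Suc n)
    have spF: "space (F n) = space M" for n using mc by (auto simp: markov_chain_def subalgebra_def)
    have TF: "{w \<in> space M. T w \<le> n} \<in> sets (F n)" for n
      using stopping_timeD[OF stop, of n] by (simp add: pred_def spF)
    have TM: "T \<in> measurable M (count_space UNIV)" by (rule strong_stationary_time_measurable[OF sst])
    have XF: "{w \<in> space M. X (Suc n) w = y} \<in> sets M"
      using markov_chain_sets_mono(2)[OF mc order.refl
          markov_chain_event_sets[OF mc sets.top, of "Suc n" "{y}"]] by (simp add: spF)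
    have Tset: "{w \<in> space M. T w \<in> A} \<in> sets M" for A
      using measurable_sets[OF TM, of A] by (simp add: vimage_def Int_def conj_commute)
    have split: "measure M {w \<in> space M. T w \<le> Suc n \<and> Q w} =
        measure M {w \<in> space M. T w \<le> n \<and> Q w} + measure M {w \<in> space M. T w = Suc n \<and> Q w}"
      if Q: "{w \<in> space M. Q w} \<in> sets M" for Q
    proof -
      have "{w \<in> space M. T w \<le> Suc n \<and> Q w} =
          {w \<in> space M. T w \<le> n \<and> Q w} \<union> {w \<in> space M. T w = Suc n \<and> Q w}" by auto
      moreover have "{w \<in> space M. T w \<in> A \<and> Q w} \<in> sets M" for A
      proof -
        have "{w \<in> space M. T w \<in> A \<and> Q w} = {w \<in> space M. T w \<in> A} \<inter> {w \<in> space M. Q w}" by auto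
        then show ?thesis using Q Tset[of A] by auto
      qed
      from this[of "{..n}"] this[of "{Suc n}"]
      have "{w \<in> space M. T w \<le> n \<and> Q w} \<in> sets M" "{w \<in> space M. T w = Suc n \<and> Q w} \<in> sets M"
        by auto
      ultimately show ?thesis by (auto intro!: finite_measure_Union)
    qed
    have "measure M {w \<in> space M. T w \<le> n \<and> X (Suc n) w = y} =
        evolve E P (\<lambda>x. measure M {w \<in> space M. T w \<le> n \<and> X n w = x}) y"
      using markov_chain_step[OF mc E TF Suc.prems] by (simp add: conj_assoc)
    also have "\<dots> = measure M {w \<in> space M. T w \<le> n} * (\<Sum>x\<in>E. \<pi> x * P x y)"
      by (simp add: evolve_def Suc.IH sum_distrib_left mult.assoc)
    also have "(\<Sum>x\<in>E. \<pi> x * P x y) = \<pi> y"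
      using stat Suc.prems by (auto simp: stationary_distribution_def)
    finally show ?case
      using split[OF XF] split[of "\<lambda>_. True"] at[OF Suc.prems, of "Suc n"]
      by (simp add: algebra_simps)
  }
qed

text \<open>Half of the separation formula \<open>P(T > n) = sep(\<nu> P\<^sup>n, \<pi>)\<close>: take \<open>y\<close> to be a state at which the
  maximum in the definition of the separation is attained.\<close>

lemma strong_stationary_time_cdf_le:
  assumes sst: "strong_stationary_time E \<nu> P \<pi> M F X T" and E: "finite E" and y: "y \<in> E"
  shows "measure M {w \<in> space M. T w \<le> n} * \<pi> y \<le> (evolve E P ^^ n) \<nu> y"
proof -
  have mc: "markov_chain E \<nu> P M F X" using sst by (auto simp: strong_stationary_time_def)
  interpret prob_space M using mc by (auto simp: markov_chain_def)
  have spF: "space (F n) = space M" using mc by (auto simp: markov_chain_def subalgebra_def)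
  have "{w \<in> space M. X n w = y} \<in> sets M"
    using markov_chain_sets_mono(2)[OF mc order.refl
        markov_chain_event_sets[OF mc sets.top, of n "{y}"]] by (simp add: spF)
  then have "measure M {w \<in> space M. T w \<le> n \<and> X n w = y} \<le> measure M {w \<in> space M. X n w = y}"
    by (intro finite_measure_mono) auto
  then show ?thesis
    by (simp add: strong_stationary_time_before[OF sst E y] markov_chain_law[OF mc E y])
qed


section \<open>Markov chains driven by independent random maps\<close>

text \<open>A random map may leave \<open>S\<close> on an event of probability zero. Sending its value back to \<open>s0\<close> makes
  every path stay in \<open>S\<close>, so that all states are measurable functions into the finite set \<open>S\<close>.\<close>

definition project_into :: "'s set \<Rightarrow> 's \<Rightarrow> 's \<Rightarrow> 's" where
  "project_into S s0 s = (if s \<in> S then s else s0)"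

text \<open>The chain started from the map \<open>\<omega> 0\<close> and moved at time \<open>n\<close> by the map \<open>\<omega> n\<close>: all its randomness
  sits in a sequence of maps, which can be chosen independent.\<close>

primrec driven_path :: "'s set \<Rightarrow> 's \<Rightarrow> nat \<Rightarrow> (nat \<Rightarrow> 's \<Rightarrow> 's) \<Rightarrow> 's" where
  "driven_path S s0 0 \<omega> = project_into S s0 (\<omega> 0 s0)"
| "driven_path S s0 (Suc n) \<omega> = project_into S s0 (\<omega> (Suc n) (driven_path S s0 n \<omega>))"

lemma driven_path_cong:
  "(\<And>i. i \<le> n \<Longrightarrow> \<omega> i = \<omega>' i) \<Longrightarrow> driven_path S s0 n \<omega> = driven_path S s0 n \<omega>'"
  by (induction n) auto

lemma measurable_driven_path:
  assumes S: "finite S" "s0 \<in> S" and sets: "\<And>i. sets (D i) = UNIV" and I: "{..n} \<subseteq> I"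
  shows "driven_path S s0 n \<in> measurable (PiM I D) (count_space S)"
proof -
  have comp: "(\<lambda>\<omega>. project_into S s0 (\<omega> i s)) \<in> measurable (PiM I D) (count_space S)"
    if "i \<in> I" for i s
  proof (rule measurable_compose[where f="\<lambda>\<omega>. \<omega> i" and N="D i"])
    show "(\<lambda>u. project_into S s0 (u s)) \<in> measurable (D i) (count_space S)"
      using S sets[of i] by (auto simp: measurable_def project_into_def)
  qed (use that in auto)
  show ?thesis
    using I
  proof (induction n)
    case 0
    moreover have "driven_path S s0 0 = (\<lambda>\<omega>. project_into S s0 (\<omega> 0 s0))" by (simp add: fun_eq_iff)
    ultimately show ?case using comp[of 0 s0] by auto
  next
    case (Suc n)
    have "(\<lambda>\<omega>. project_into S s0 (\<omega> (Suc n) (driven_path S s0 n \<omega>)))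
        \<in> measurable (PiM I D) (count_space S)"
    proof (rule measurable_compose_countable'[where I=S and g="driven_path S s0 n"
          and f="\<lambda>s \<omega>. project_into S s0 (\<omega> (Suc n) s)"])
      show "(\<lambda>\<omega>. project_into S s0 (\<omega> (Suc n) s)) \<in> measurable (PiM I D) (count_space S)" for s
        using Suc.prems by (intro comp) auto
      show "driven_path S s0 n \<in> measurable (PiM I D) (count_space S)"
        using Suc by (auto simp: atMost_Suc)
    qed (use S in \<open>auto intro: countable_finite\<close>)
    moreover have "driven_path S s0 (Suc n) =
        (\<lambda>\<omega>. project_into S s0 (\<omega> (Suc n) (driven_path S s0 n \<omega>)))"
      by (simp add: fun_eq_iff)
    ultimately show ?case by (simp del: driven_path.simps)
  qed
qed

text \<open>The map used at time \<open>n + 1\<close> sends every state \<open>s\<close> to a random state with law \<open>K n s\<close>. These maps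
  are independent coordinates of an infinite product, and the filtration consists of the events that
  depend on coordinates up to \<open>n\<close> only. The Markov property is then the independence of coordinate
  \<open>n + 1\<close> from the coordinates before it. Kernels that vary with time are needed below, since the
  probability of a mark does.\<close>

lemma exists_inhomogeneous_markov_chain:
  fixes K :: "nat \<Rightarrow> 's \<Rightarrow> 's pmf" and I :: "'s pmf"
  assumes S: "finite S" and I: "set_pmf I \<subseteq> S" and K: "\<And>n s. s \<in> S \<Longrightarrow> set_pmf (K n s) \<subseteq> S"
  shows "\<exists>(M :: (nat \<Rightarrow> 's \<Rightarrow> 's) measure) F W.
    prob_space M \<and> filtration (space M) F \<and> (\<forall>n. subalgebra M (F n)) \<and>
    (\<forall>n. W n \<in> measurable (F n) (count_space S)) \<and>
    (\<forall>s\<in>S. measure M {w \<in> space M. W 0 w = s} = pmf I s) \<and>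
    (\<forall>n. \<forall>A\<in>sets (F n). \<forall>s\<in>S. \<forall>t\<in>S.
       measure M {w \<in> A. W n w = s \<and> W (Suc n) w = t} =
       measure M {w \<in> A. W n w = s} * pmf (K n s) t)"
proof -
  obtain s0 where s0: "s0 \<in> S" using I set_pmf_not_empty[of I] by blast
  \<comment> \<open>At time \<open>0\<close> the random map is constant, so it places the chain according to \<open>I\<close>.\<close>
  define \<mu> where "\<mu> n = (case n of 0 \<Rightarrow> map_pmf (\<lambda>s _. s) I | Suc m \<Rightarrow> Pi_pmf S s0 (K m))" for n
  define D where "D n = measure_pmf (\<mu> n)" for n
  define M where "M = PiM UNIV D"
  define F where "F n = vimage_algebra (space M) (\<lambda>\<omega>. restrict \<omega> {..n}) (PiM {..n} D)" for n
  define W where "W = driven_path S s0"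
  have setsD: "sets (D i) = UNIV" and spD: "space (D i) = UNIV" for i by (auto simp: D_def)
  interpret D: prob_space "D i" for i unfolding D_def by (rule prob_space_measure_pmf)
  interpret P: product_prob_space D UNIV ..
  interpret M: prob_space M unfolding M_def by (rule P.prob_space_axioms)
  have spM: "space M = UNIV" by (auto simp: M_def space_PiM spD)
  have R: "(\<lambda>\<omega>. restrict \<omega> J) \<in> measurable M (PiM J D)" for J
    unfolding M_def by (rule measurable_restrict_subset) simp
  have setsF: "sets (F n) = {(\<lambda>\<omega>. restrict \<omega> {..n}) -` B |B. B \<in> sets (PiM {..n} D)}" for n
    unfolding F_def using measurable_space[OF R] by (subst sets_vimage_algebra2) (auto simp: spM)
  have spF: "space (F n) = space M" for n by (simp add: F_def)
  have FM: "sets (F n) \<subseteq> sets M" for n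
    using measurable_sets[OF R] by (auto simp: setsF spM)
  have Fmono: "sets (F m) \<subseteq> sets (F n)" if "m \<le> n" for m n
  proof
    fix A assume "A \<in> sets (F m)"
    then obtain B where B: "B \<in> sets (PiM {..m} D)" and A: "A = (\<lambda>\<omega>. restrict \<omega> {..m}) -` B"
      by (auto simp: setsF)
    have "(\<lambda>\<omega>. restrict \<omega> {..m}) -` B \<inter> space (PiM {..n} D) \<in> sets (PiM {..n} D)"
      by (rule measurable_sets[OF measurable_restrict_subset B]) (use that in auto)
    moreover have "A = (\<lambda>\<omega>. restrict \<omega> {..n}) -`
        ((\<lambda>\<omega>. restrict \<omega> {..m}) -` B \<inter> space (PiM {..n} D))"
      using that by (auto simp: A space_PiM spD Int_absorb1)
    ultimately show "A \<in> sets (F n)" unfolding setsF by blast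
  qed
  have W_restrict: "W n (restrict \<omega> {..n}) = W n \<omega>" for n \<omega>
    unfolding W_def by (rule driven_path_cong) auto
  have WF: "W n \<in> measurable (F n) (count_space S)" for n
  proof -
    have 1: "W n \<in> measurable (PiM {..n} D) (count_space S)"
      unfolding W_def by (rule measurable_driven_path) (use S s0 setsD in auto)
    have 2: "(\<lambda>\<omega>. restrict \<omega> {..n}) \<in> measurable (F n) (PiM {..n} D)"
      unfolding F_def by (rule measurable_vimage_algebra1) (use measurable_space[OF R] in auto)
    show ?thesis using measurable_compose[OF 2 1] by (simp add: W_restrict)
  qed
  have marg: "measure M {\<omega>. \<omega> n \<in> U} = measure (D n) U" for n U
  proof -
    have "measure (distr M (D n) (\<lambda>\<omega>. \<omega> n)) U = measure M ((\<lambda>\<omega>. \<omega> n) -` U \<inter> space M)"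
      by (rule measure_distr) (auto simp: M_def setsD)
    then show ?thesis
      by (simp add: M_def[symmetric] P.PiM_component[of n, simplified, folded M_def] spM vimage_def)
  qed
  have init: "measure M {w \<in> space M. W 0 w = s} = pmf I s" if s: "s \<in> S" for s
  proof -
    have "measure M {w \<in> space M. W 0 w = s} = measure (D 0) {f. project_into S s0 (f s0) = s}"
      using marg[of 0 "{f. project_into S s0 (f s0) = s}"] by (simp add: W_def spM)
    also have "\<dots> = measure I {x. project_into S s0 x = s}"
      by (simp add: D_def \<mu>_def vimage_def)
    also have "\<dots> = measure I {s}"
      by (rule measure_pmf.finite_measure_eq_AE)
         (use I in \<open>auto simp: AE_measure_pmf_iff project_into_def\<close>)
    finally show ?thesis by (simp add: measure_pmf_single)
  qed
  \<comment> \<open>Coordinates of a product measure are independent: their joint law is the product itself.\<close>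
  have ind: "M.indep_vars D (\<lambda>i \<omega>. \<omega> i) UNIV"
  proof (subst M.indep_vars_iff_distr_eq_PiM')
    show "distr M (PiM UNIV D) (\<lambda>x. \<lambda>i\<in>UNIV. x i) = PiM UNIV (\<lambda>i. distr M (D i) (\<lambda>\<omega>. \<omega> i))"
      by (simp add: M_def P.PiM_component restrict_UNIV distr_id)
  qed (auto simp: M_def)
  have step: "measure M {w \<in> A. W n w = s \<and> W (Suc n) w = t} =
       measure M {w \<in> A. W n w = s} * pmf (K n s) t"
    if A: "A \<in> sets (F n)" and s: "s \<in> S" and t: "t \<in> S" for n A s t
  proof -
    let ?C = "{w \<in> A. W n w = s}" and ?U = "{f. project_into S s0 (f s) = t}"
    have "?C = A \<inter> (W n -` {s} \<inter> space (F n))"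
      using sets.sets_into_space[OF A] by auto
    then have "?C \<in> sets (F n)" using A measurable_sets[OF WF, of "{s}" n] s by auto
    then obtain B where B: "B \<in> sets (PiM {..n} D)" and C: "?C = (\<lambda>\<omega>. restrict \<omega> {..n}) -` B"
      unfolding setsF by blast
    have ind_n: "M.indep_var (PiM {..n} D) (\<lambda>\<omega>. restrict (\<lambda>i. \<omega> i) {..n})
        (PiM {Suc n} D) (\<lambda>\<omega>. restrict (\<lambda>i. \<omega> i) {Suc n})"
      by (rule M.indep_var_restrict[OF ind]) auto
    let ?V = "(\<lambda>x. x (Suc n)) -` ?U \<inter> space (PiM {Suc n} D)"
    have "?V \<in> sets (PiM {Suc n} D)"
      by (rule measurable_sets[OF measurable_component_singleton]) (auto simp: setsD)
    from M.indep_varD[OF ind_n B this]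
    have *: "measure M (?C \<inter> {\<omega>. \<omega> (Suc n) \<in> ?U}) = measure M ?C * measure M {\<omega>. \<omega> (Suc n) \<in> ?U}"
      unfolding C by (simp add: spD spM space_PiM vimage_def Int_def)
    have "measure M {\<omega>. \<omega> (Suc n) \<in> ?U} = measure (Pi_pmf S s0 (K n)) ?U"
      by (simp only: marg) (simp add: D_def \<mu>_def)
    also have "\<dots> = measure (map_pmf (\<lambda>f. f s) (Pi_pmf S s0 (K n))) {x. project_into S s0 x = t}"
      by (simp add: vimage_def)
    also have "\<dots> = measure (K n s) {x. project_into S s0 x = t}"
      using S s by (simp add: Pi_pmf_component)
    also have "\<dots> = measure (K n s) {t}"
      by (rule measure_pmf.finite_measure_eq_AE)
         (use K[OF s, of n] in \<open>auto simp: AE_measure_pmf_iff project_into_def\<close>)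
    finally have "measure M {\<omega>. \<omega> (Suc n) \<in> ?U} = pmf (K n s) t" by (simp add: measure_pmf_single)
    moreover have "{w \<in> A. W n w = s \<and> W (Suc n) w = t} = ?C \<inter> {\<omega>. \<omega> (Suc n) \<in> ?U}"
      by (auto simp: W_def)
    ultimately show ?thesis using * by simp
  qed
  have "filtration (space M) F" by standard (auto simp: spF Fmono)
  moreover have "subalgebra M (F n)" for n by (simp add: subalgebra_def spF FM)
  ultimately show ?thesis
    using M.prob_space_axioms WF init step by blast
qed

section \<open>Stopping a chain at its first mark\<close>

text \<open>A stopping time has to be finite at every point of the sample space, while natural constructions
  give one that is finite almost surely. Discarding a null set repairs this.\<close>

lemma markov_chain_restrict_space:
  assumes mc: "markov_chain E \<nu> P M F X" and G: "G \<in> sets M" "measure M G = 1"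
  shows "markov_chain E \<nu> P (restrict_space M G) (\<lambda>n. restrict_space (F n) G) X"
  unfolding markov_chain_def
proof (intro conjI allI ballI)
  interpret prob_space M using mc by (auto simp: markov_chain_def)
  have spF: "space (F n) = space M" and sub: "sets (F n) \<subseteq> sets M"
    and X: "X n \<in> measurable (F n) (count_space E)" for n
    using mc by (auto simp: markov_chain_def subalgebra_def)
  have mono: "sets (F m) \<subseteq> sets (F n)" if "m \<le> n" for m n
    using mc that by (meson markov_chain_def filtration.sets_F_mono)
  have init: "measure M {w \<in> space M. X 0 w = x} = \<nu> x" if "x \<in> E" for x
    using mc that unfolding markov_chain_def by blast
  have mp: "measure M {w \<in> A. X n w = x \<and> X (Suc n) w = y} = measure M {w \<in> A. X n w = x} * P x y"
    if "A \<in> sets (F n)" "x \<in> E" "y \<in> E" for n A x y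
    using mc that unfolding markov_chain_def by blast
  have Gsp: "G \<subseteq> space M" using G sets.sets_into_space by auto
  have full: "measure M (A \<inter> G) = measure M A" if "A \<in> sets M" for A
    by (rule finite_measure_eq_AE) (use that G AE_prob_1[OF G(2)] in auto)
  have rm: "measure (restrict_space M G) A = measure M A" if "A \<subseteq> G" for A
    using that G by (intro measure_restrict_space) auto
  show "prob_space (restrict_space M G)"
    by (rule prob_spaceI) (use G Gsp in \<open>auto simp: emeasure_restrict_space space_restrict_space
        emeasure_eq_measure Int_absorb2\<close>)
  show "filtration (space (restrict_space M G)) (\<lambda>n. restrict_space (F n) G)"
    by standard (use mono in \<open>auto simp: space_restrict_space spF sets_restrict_space\<close>)
  show "subalgebra (restrict_space M G) (restrict_space (F n) G)" for n
    using sub by (auto simp: subalgebra_def space_restrict_space spF sets_restrict_space)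
  show "X n \<in> measurable (restrict_space (F n) G) (count_space E)" for n
    by (rule measurable_restrict_space1[OF X])
  have Xset: "{w \<in> A. X n w \<in> B} \<in> sets M" if "A \<in> sets (F n)" for A B n
    using markov_chain_event_sets[OF mc that] sub by blast
  show "measure (restrict_space M G) {w \<in> space (restrict_space M G). X 0 w = x} = \<nu> x"
    if "x \<in> E" for x
  proof -
    have "{w \<in> space (restrict_space M G). X 0 w = x} = {w \<in> space M. X 0 w = x} \<inter> G"
      using Gsp by (auto simp: space_restrict_space)
    moreover have "{w \<in> space M. X 0 w = x} \<in> sets M"
      using Xset[OF sets.top[of "F 0"], of "{x}"] by (simp add: spF)
    ultimately show ?thesis using full init[OF that] rm[of "{w \<in> space M. X 0 w = x} \<inter> G"] by simp
  qed
  fix n A x y assume A: "A \<in> sets (restrict_space (F n) G)" and x: "x \<in> E" and y: "y \<in> E"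
  then obtain A' where A': "A' \<in> sets (F n)" and AA: "A = A' \<inter> G"
    by (auto simp: sets_restrict_space)
  have 1: "{w \<in> A'. X n w = x} \<in> sets (F n)"
    using markov_chain_event_sets[OF mc A', of "{x}"] by simp
  have 2: "{w \<in> A'. X n w = x \<and> X (Suc n) w = y} \<in> sets M"
    using Xset[OF subsetD[OF mono[of n "Suc n"] 1], of "{y}"] by (simp add: conj_assoc)
  have e: "{w \<in> A. X n w = x} = {w \<in> A'. X n w = x} \<inter> G"
      "{w \<in> A. X n w = x \<and> X (Suc n) w = y} = {w \<in> A'. X n w = x \<and> X (Suc n) w = y} \<inter> G"
    by (auto simp: AA)
  show "measure (restrict_space M G) {w \<in> A. X n w = x \<and> X (Suc n) w = y} =
      measure (restrict_space M G) {w \<in> A. X n w = x} * P x y"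
    unfolding e rm[OF Int_lower2] full[OF 2] full[OF subsetD[OF sub 1]] by (rule mp[OF A' x y])
qed

text \<open>If the first mark appears at time \<open>n\<close> in state \<open>x\<close> with probability \<open>\<delta> n * \<pi> x\<close>, then the time and
  the place of the first mark have a product law with second factor \<open>\<pi>\<close>, which is what strong
  stationarity requires.\<close>

lemma first_mark_strong_stationary_time:
  fixes M :: "'w measure"
  assumes mc: "markov_chain E \<nu> P M F X" and E: "finite E" and stat: "stationary_distribution E P \<pi>"
    and Z: "\<And>n. Measurable.pred (F n) (Z n)"
    and finite_mark: "measure M {w \<in> space M. \<exists>n. Z n w} = 1"
    and mark: "\<And>n x. x \<in> E \<Longrightarrow>
      measure M {w \<in> space M. (\<forall>k<n. \<not> Z k w) \<and> Z n w \<and> X n w = x} = \<delta> n * \<pi> x"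
  shows "\<exists>(M' :: 'w measure) F' T. strong_stationary_time E \<nu> P \<pi> M' F' X T \<and>
    (\<forall>n. measure M' {w \<in> space M'. T w \<le> n} = (\<Sum>k\<le>n. \<delta> k))"
proof -
  define G where "G = {w \<in> space M. \<exists>n. Z n w}"
  define T where "T w = (LEAST n. Z n w)" for w
  let ?M = "restrict_space M G"
  interpret prob_space M using mc by (auto simp: markov_chain_def)
  have spF: "space (F n) = space M" and sub: "sets (F n) \<subseteq> sets M" for n
    using mc by (auto simp: markov_chain_def subalgebra_def)
  have ZF: "{w \<in> space M. Z k w} \<in> sets (F n)" if "k \<le> n" for k n
    by (rule markov_chain_sets_mono(1)[OF mc that]) (use Z[of k] in \<open>simp add: pred_def spF\<close>)
  have G: "G \<in> sets M"
  proof -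
    have "G = (\<Union>n. {w \<in> space M. Z n w})" by (auto simp: G_def)
    moreover have "{w \<in> space M. Z n w} \<in> sets M" for n using ZF[of n n] sub[of n] by blast
    ultimately show ?thesis by (simp add: sets.countable_UN)
  qed
  have mc': "markov_chain E \<nu> P ?M (\<lambda>n. restrict_space (F n) G) X"
    by (rule markov_chain_restrict_space[OF mc G]) (use finite_mark in \<open>simp add: G_def\<close>)
  interpret R: prob_space ?M using mc' unfolding markov_chain_def by blast
  have spM: "space ?M = G" by (auto simp: space_restrict_space G_def)
  have rm: "measure ?M A = measure M A" if "A \<subseteq> G" for A
    using that G by (intro measure_restrict_space) auto
  have Z_T: "Z (T w) w" if "w \<in> G" for w
    using that LeastI_ex[of "\<lambda>n. Z n w"] by (simp add: T_def G_def)
  have T_min: "T w \<le> k" if "Z k w" for w k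
    using that unfolding T_def by (rule Least_le)
  have T_le: "T w \<le> n \<longleftrightarrow> (\<exists>k\<le>n. Z k w)" if "w \<in> G" for w n
  proof
    show "\<exists>k\<le>n. Z k w" if "T w \<le> n" using that Z_T[OF \<open>w \<in> G\<close>] by blast
    show "T w \<le> n" if "\<exists>k\<le>n. Z k w" using that T_min order.trans by blast
  qed
  have T_eq: "T w = n \<longleftrightarrow> (\<forall>k<n. \<not> Z k w) \<and> Z n w" if "w \<in> G" for w n
  proof
    show "(\<forall>k<n. \<not> Z k w) \<and> Z n w" if "T w = n"
      using that Z_T[OF \<open>w \<in> G\<close>] T_min[of _ w] by (auto simp: not_le[symmetric])
    show "T w = n" if "(\<forall>k<n. \<not> Z k w) \<and> Z n w"
      using that Z_T[OF \<open>w \<in> G\<close>] T_min[of n w] by (auto simp: le_less)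
  qed
  have stop: "stopping_time (\<lambda>n. restrict_space (F n) G) T"
  proof
    fix n
    let ?Z = "{w \<in> space M. \<exists>k\<le>n. Z k w}"
    have "?Z = (\<Union>k\<in>{..n}. {w \<in> space M. Z k w})" by auto
    also have "\<dots> \<in> sets (F n)" by (intro sets.finite_UN ZF) auto
    finally have Z_n: "?Z \<in> sets (F n)" .
    have "{w \<in> space (restrict_space (F n) G). T w \<le> n} = G \<inter> ?Z"
      unfolding space_restrict_space spF using T_le[of _ n] by blast
    then show "Measurable.pred (restrict_space (F n) G) (\<lambda>w. T w \<le> n)"
      unfolding pred_def sets_restrict_space using Z_n by (rule image_eqI)
  qed
  define D where "D n B = {w \<in> G. T w = n \<and> X n w \<in> B}" for n B
  have D_M: "D n B = {w \<in> space M. (\<forall>k<n. \<not> Z k w) \<and> Z n w \<and> X n w \<in> B}" for n B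
  proof -
    have "w \<in> D n B \<longleftrightarrow> w \<in> space M \<and> (\<forall>k<n. \<not> Z k w) \<and> Z n w \<and> X n w \<in> B" for w
      using T_eq[of w n] unfolding D_def G_def by blast
    then show ?thesis by blast
  qed
  have D_sets: "D n B \<in> sets M" for n B
  proof -
    have "{w \<in> space M. (\<forall>k<n. \<not> Z k w) \<and> Z n w} =
        {w \<in> space M. Z n w} - (\<Union>k\<in>{..<n}. {w \<in> space M. Z k w})" by auto
    also have "\<dots> \<in> sets (F n)" by (intro sets.Diff sets.finite_UN ZF) auto
    finally have "{w \<in> space M. (\<forall>k<n. \<not> Z k w) \<and> Z n w} \<in> sets (F n)" .
    from subsetD[OF sub markov_chain_event_sets[OF mc this, of B]] show ?thesis
      unfolding D_M mem_Collect_eq conj_assoc .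
  qed
  have D_prob: "measure ?M (D n B) = \<delta> n * (\<Sum>x\<in>B. \<pi> x)" if B: "B \<subseteq> E" for n B
  proof -
    have disj: "disjoint_family_on (\<lambda>x. D n {x}) B"
      unfolding disjoint_family_on_def D_def by blast
    have single: "measure M (D n {x}) = \<delta> n * \<pi> x" if "x \<in> E" for x
      using mark[OF that, of n] by (simp add: D_M)
    have "D n B = (\<Union>x\<in>B. D n {x})" unfolding D_def by blast
    then have "measure M (D n B) = measure M (\<Union>x\<in>B. D n {x})" by simp
    also have "\<dots> = (\<Sum>x\<in>B. measure M (D n {x}))"
      using D_sets by (intro finite_measure_finite_Union finite_subset[OF B E] disj) blast
    also have "\<dots> = (\<Sum>x\<in>B. \<delta> n * \<pi> x)"
      using B single by (intro sum.cong) auto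
    finally have "measure M (D n B) = \<delta> n * (\<Sum>x\<in>B. \<pi> x)" by (simp add: sum_distrib_left)
    moreover have "D n B \<subseteq> G" unfolding D_def by blast
    ultimately show ?thesis by (simp add: rm)
  qed
  \<comment> \<open>Summation over the value \<open>n\<close> of \<open>T\<close>; all requirements on \<open>T\<close> are special cases.\<close>
  have joint: "(\<lambda>n. (if n \<in> A then \<delta> n else 0) * (\<Sum>x\<in>B. \<pi> x)) sums
      measure ?M {w \<in> space ?M. T w \<in> A \<and> X (T w) w \<in> B}" if B: "B \<subseteq> E" for A B
  proof -
    define H where "H n = (if n \<in> A then D n B else {})" for n
    have "D n B \<in> sets ?M" for n
    proof -
      have "D n B \<subseteq> G" unfolding D_def by blast
      then show ?thesis using D_sets G by (simp add: sets_restrict_space_iff)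
    qed
    then have Hs: "range H \<subseteq> sets ?M" by (simp add: H_def image_subset_iff)
    have "disjoint_family H"
      unfolding disjoint_family_on_def H_def D_def by (simp split: if_split) blast
    from R.finite_measure_UNION[OF Hs this]
    have "(\<lambda>n. measure ?M (H n)) sums measure ?M (\<Union>n. H n)" .
    moreover have "measure ?M (H n) = (if n \<in> A then \<delta> n else 0) * (\<Sum>x\<in>B. \<pi> x)" for n
      using D_prob[OF B] by (simp add: H_def)
    moreover have "(\<Union>n. H n) = {w \<in> space ?M. T w \<in> A \<and> X (T w) w \<in> B}"
      unfolding H_def D_def spM by (auto split: if_split_asm)
    ultimately show ?thesis by simp
  qed
  have sum_E: "(\<Sum>x\<in>E. \<pi> x) = 1" using stat by (auto simp: stationary_distribution_def)
  have inE: "X n w \<in> E" if "w \<in> G" for n w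
  proof -
    have "X n \<in> measurable (F n) (count_space E)" using mc unfolding markov_chain_def by blast
    from measurable_space[OF this, of w] that show ?thesis by (simp add: G_def spF)
  qed
  have time: "(\<lambda>n. if n \<in> A then \<delta> n else 0) sums measure ?M {w \<in> space ?M. T w \<in> A}" for A
  proof -
    have "{w \<in> space ?M. T w \<in> A \<and> X (T w) w \<in> E} = {w \<in> space ?M. T w \<in> A}"
      using inE by (auto simp: spM)
    with joint[of E A] show ?thesis by (simp add: sum_E)
  qed
  have product: "measure ?M {w \<in> space ?M. T w \<in> A \<and> X (T w) w \<in> B} =
      measure ?M {w \<in> space ?M. T w \<in> A} * (\<Sum>x\<in>B. \<pi> x)" if B: "B \<subseteq> E" for A B
    by (rule sums_unique2[OF joint[OF B] sums_mult2[OF time]])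
  have place: "measure ?M {w \<in> space ?M. X (T w) w \<in> B} = (\<Sum>x\<in>B. \<pi> x)" if "B \<subseteq> E" for B
    using product[OF that, of UNIV] R.prob_space by simp
  have "strong_stationary_time E \<nu> P \<pi> ?M (\<lambda>n. restrict_space (F n) G) X T"
    unfolding strong_stationary_time_def
  proof (intro conjI allI ballI impI)
    show "measure ?M {w \<in> space ?M. X (T w) w = x} = \<pi> x" if "x \<in> E" for x
      using place[of "{x}"] that by simp
    show "measure ?M {w \<in> space ?M. T w \<in> A \<and> X (T w) w \<in> B} =
        measure ?M {w \<in> space ?M. T w \<in> A} * measure ?M {w \<in> space ?M. X (T w) w \<in> B}"
      if "B \<subseteq> E" for A B
      by (simp only: product[OF that] place[OF that])
  qed (fact stat mc' stop)+
  moreover have "measure ?M {w \<in> space ?M. T w \<le> n} = (\<Sum>k\<le>n. \<delta> k)" for n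
    using sums_unique2[OF time[of "{..n}"] sums_If_finite_set[of "{..n}" \<delta>]] by simp
  ultimately show ?thesis by blast
qed

section \<open>The fastest strong stationary time from the separation\<close>

lemma exists_pmf_on_finite:
  fixes f :: "'e \<Rightarrow> real"
  assumes E: "finite E" and nonneg: "\<And>x. x \<in> E \<Longrightarrow> 0 \<le> f x" and sum: "(\<Sum>x\<in>E. f x) = 1"
  shows "\<exists>q. set_pmf q \<subseteq> E \<and> (\<forall>x\<in>E. pmf q x = f x)"
proof -
  define g where "g x = (if x \<in> E then f x else 0)" for x
  have g0: "0 \<le> g x" for x using nonneg by (simp add: g_def)
  have "(\<integral>\<^sup>+x. ennreal (g x) \<partial>count_space UNIV) = (\<Sum>x\<in>E. ennreal (g x))"
    by (rule nn_integral_count_space') (use E in \<open>auto simp: g_def\<close>)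
  also have "\<dots> = ennreal (\<Sum>x\<in>E. g x)" by (rule sum_ennreal) (rule g0)
  also have "(\<Sum>x\<in>E. g x) = 1" using sum by (simp add: g_def)
  finally have "pmf (embed_pmf g) x = g x" for x
    using g0 by (subst pmf_embed_pmf) auto
  then show ?thesis
    by (intro exI[of _ "embed_pmf g"]) (auto simp: g_def set_pmf_eq split: if_split_asm)
qed

text \<open>A random state together with a mark, set with a probability that depends on the state.\<close>

definition marked_pmf :: "'e pmf \<Rightarrow> ('e \<Rightarrow> real) \<Rightarrow> ('e \<times> bool) pmf" where
  "marked_pmf \<mu> c = bind_pmf \<mu> (\<lambda>y. map_pmf (Pair y) (bernoulli_pmf (c y)))"

lemma pmf_marked_pmf:
  assumes "0 \<le> c y" "c y \<le> 1"
  shows "pmf (marked_pmf \<mu> c) (y, b) = pmf \<mu> y * (if b then c y else 1 - c y)"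
proof -
  have inner: "pmf (map_pmf (Pair z) (bernoulli_pmf (c z))) (y, b) =
      pmf (bernoulli_pmf (c y)) b * indicator {y} z" for z
  proof (cases "z = y")
    case True
    moreover have "inj (Pair y :: bool \<Rightarrow> _)" by (simp add: inj_def)
    ultimately show ?thesis using pmf_map_inj'[of "Pair y" "bernoulli_pmf (c y)" b] by simp
  next
    case False
    then have "(y, b) \<notin> set_pmf (map_pmf (Pair z) (bernoulli_pmf (c z)))" by auto
    then show ?thesis using False by (simp add: pmf_eq_0_set_pmf)
  qed
  have "pmf (marked_pmf \<mu> c) (y, b) = pmf (bernoulli_pmf (c y)) b * pmf \<mu> y"
    unfolding marked_pmf_def pmf_bind inner by (simp add: measure_pmf_single)
  then show ?thesis using assms by (cases b) (auto simp: mult.commute)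
qed

lemma set_marked_pmf: "set_pmf (marked_pmf \<mu> c) \<subseteq> set_pmf \<mu> \<times> UNIV"
  by (auto simp: marked_pmf_def)

text \<open>Let \<open>\<mu>\<^sub>n = \<nu> P\<^sup>n\<close>. The invariant is that the unmarked part of the chain at time \<open>n\<close> has mass
  \<open>\<mu>\<^sub>n - a(n) \<pi>\<close>. One step of \<open>P\<close> turns it into \<open>\<mu>\<^bsub>n+1\<^esub> - a(n) \<pi>\<close>, since \<open>\<pi>\<close> is stationary, and
  marking state \<open>y\<close> with probability \<open>(a(n+1) - a(n)) \<pi>(y) / (\<mu>\<^bsub>n+1\<^esub>(y) - a(n) \<pi>(y))\<close> removes exactly
  \<open>(a(n+1) - a(n)) \<pi>(y)\<close>. The bound \<open>a(n+1) \<pi> \<le> \<mu>\<^bsub>n+1\<^esub>\<close> says that this is a probability, and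
  \<open>a(n) \<rightarrow> 1\<close> that a mark appears almost surely.\<close>

lemma exists_strong_stationary_time:
  fixes E :: "'e set" and a :: "nat \<Rightarrow> real"
  assumes E: "finite E"
    and P0: "\<And>x y. x \<in> E \<Longrightarrow> y \<in> E \<Longrightarrow> 0 \<le> P x y"
    and P1: "\<And>x. x \<in> E \<Longrightarrow> (\<Sum>y\<in>E. P x y) = 1"
    and \<nu>0: "\<And>x. x \<in> E \<Longrightarrow> 0 \<le> \<nu> x" and \<nu>1: "(\<Sum>x\<in>E. \<nu> x) = 1"
    and stat: "stationary_distribution E P \<pi>"
    and a0: "0 \<le> a 0" and a_mono: "\<And>n. a n \<le> a (Suc n)" and a_lim: "a \<longlonglongrightarrow> 1"
    and a_le: "\<And>n y. y \<in> E \<Longrightarrow> a n * \<pi> y \<le> (evolve E P ^^ n) \<nu> y"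
  shows "\<exists>(M :: (nat \<Rightarrow> 'e \<times> bool \<Rightarrow> 'e \<times> bool) measure) F X T.
    strong_stationary_time E \<nu> P \<pi> M F X T \<and> (\<forall>n. measure M {w \<in> space M. T w \<le> n} = a n)"
proof -
  have \<pi>0: "0 \<le> \<pi> x" if "x \<in> E" for x
    using stat that by (auto simp: stationary_distribution_def)
  have \<pi>1: "(\<Sum>x\<in>E. \<pi> x) = 1" using stat by (auto simp: stationary_distribution_def)
  have \<pi>P: "(\<Sum>x\<in>E. \<pi> x * P x y) = \<pi> y" if "y \<in> E" for y
    using stat that by (auto simp: stationary_distribution_def)
  define \<mu> where "\<mu> n = (evolve E P ^^ n) \<nu>" for n
  have \<mu>_Suc: "\<mu> (Suc n) y = (\<Sum>x\<in>E. \<mu> n x * P x y)" for n y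
    by (simp add: \<mu>_def evolve_def)
  have \<mu>_sum: "(\<Sum>x\<in>E. \<mu> n x) = 1" for n
  proof (induction n)
    case (Suc n)
    have "(\<Sum>y\<in>E. \<mu> (Suc n) y) = (\<Sum>x\<in>E. \<Sum>y\<in>E. \<mu> n x * P x y)"
      unfolding \<mu>_Suc by (rule sum.swap)
    then show ?case using Suc by (simp add: sum_distrib_left[symmetric] P1)
  qed (simp add: \<mu>_def \<nu>1)
  \<comment> \<open>\<open>b n\<close> is \<open>a (n - 1)\<close>, read as \<open>0\<close> at \<open>n = 0\<close>: a first mark may already appear at time \<open>0\<close>.\<close>
  define b where "b n = (case n of 0 \<Rightarrow> 0 | Suc m \<Rightarrow> a m)" for n
  have b_le: "b n \<le> a n" for n using a0 a_mono by (auto simp: b_def split: nat.split)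
  define c where "c n y = (a n - b n) * \<pi> y / (\<mu> n y - b n * \<pi> y)" for n y
  have gap: "0 \<le> (a n - b n) * \<pi> y" "(a n - b n) * \<pi> y \<le> \<mu> n y - b n * \<pi> y" if "y \<in> E" for n y
    using a_le[OF that, of n] mult_right_mono[OF b_le[of n] \<pi>0[OF that]]
    by (simp_all add: \<mu>_def left_diff_distrib)
  have c01: "0 \<le> c n y" "c n y \<le> 1" if "y \<in> E" for n y
    using gap[OF that, of n] by (auto simp: c_def intro!: divide_nonneg_nonneg divide_le_eq_1[THEN iffD2])
  \<comment> \<open>This includes states where the denominator of \<open>c\<close> vanishes, since then the numerator does too.\<close>
  have c_mult: "(\<mu> n y - b n * \<pi> y) * c n y = (a n - b n) * \<pi> y" if "y \<in> E" for n y
    using gap[OF that, of n] by (auto simp: c_def)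
  obtain q0 where q0: "set_pmf q0 \<subseteq> E" "\<And>x. x \<in> E \<Longrightarrow> pmf q0 x = \<nu> x"
    using exists_pmf_on_finite[OF E \<nu>0 \<nu>1] by blast
  have "\<forall>x\<in>E. \<exists>q. set_pmf q \<subseteq> E \<and> (\<forall>y\<in>E. pmf q y = P x y)"
    using exists_pmf_on_finite[OF E P0 P1] by blast
  then obtain Q where Q: "\<And>x. x \<in> E \<Longrightarrow> set_pmf (Q x) \<subseteq> E"
      "\<And>x y. x \<in> E \<Longrightarrow> y \<in> E \<Longrightarrow> pmf (Q x) y = P x y"
    unfolding bchoice_iff by blast
  define I where "I = marked_pmf q0 (c 0)"
  define K where "K n s = marked_pmf (Q (fst s)) (c (Suc n))" for n and s :: "'e \<times> bool"
  have "\<exists>(M :: (nat \<Rightarrow> 'e \<times> bool \<Rightarrow> 'e \<times> bool) measure) F W.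
    prob_space M \<and> filtration (space M) F \<and> (\<forall>n. subalgebra M (F n)) \<and>
    (\<forall>n. W n \<in> measurable (F n) (count_space (E \<times> UNIV))) \<and>
    (\<forall>s\<in>E \<times> UNIV. measure M {w \<in> space M. W 0 w = s} = pmf I s) \<and>
    (\<forall>n. \<forall>A\<in>sets (F n). \<forall>s\<in>E \<times> UNIV. \<forall>t\<in>E \<times> UNIV.
       measure M {w \<in> A. W n w = s \<and> W (Suc n) w = t} =
       measure M {w \<in> A. W n w = s} * pmf (K n s) t)"
  proof (rule exists_inhomogeneous_markov_chain)
    show "finite (E \<times> (UNIV :: bool set))" using E by simp
    show "set_pmf I \<subseteq> E \<times> UNIV" using set_marked_pmf[of q0 "c 0"] q0 by (auto simp: I_def)
    show "set_pmf (K n s) \<subseteq> E \<times> UNIV" if "s \<in> E \<times> UNIV" for n s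
      using set_marked_pmf[of "Q (fst s)" "c (Suc n)"] Q that by (fastforce simp: K_def)
  qed
  then obtain M :: "(nat \<Rightarrow> 'e \<times> bool \<Rightarrow> 'e \<times> bool) measure" and F W where
    ps: "prob_space M" and fil: "filtration (space M) F" and sub: "\<And>n. subalgebra M (F n)"
    and WF: "\<And>n. W n \<in> measurable (F n) (count_space (E \<times> UNIV))"
    and W0: "\<And>s. s \<in> E \<times> UNIV \<Longrightarrow> measure M {w \<in> space M. W 0 w = s} = pmf I s"
    and WS: "\<And>n A s t. A \<in> sets (F n) \<Longrightarrow> s \<in> E \<times> UNIV \<Longrightarrow> t \<in> E \<times> UNIV \<Longrightarrow>
       measure M {w \<in> A. W n w = s \<and> W (Suc n) w = t} =
       measure M {w \<in> A. W n w = s} * pmf (K n s) t"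
    by blast
  interpret prob_space M by fact
  define X where "X n w = fst (W n w)" for n w
  define Z where "Z n w = snd (W n w)" for n w
  have spF: "space (F n) = space M" and subs: "sets (F n) \<subseteq> sets M" for n
    using sub[of n] by (auto simp: subalgebra_def)
  have FSuc: "sets (F n) \<subseteq> sets (F (Suc n))" for n
    using filtration.sets_F_mono[OF fil, of n "Suc n"] by simp
  have evF: "{w \<in> A. W n w \<in> B} \<in> sets (F n)" if A: "A \<in> sets (F n)" for A B n
  proof -
    have "{w \<in> A. W n w \<in> B} = A \<inter> (W n -` (B \<inter> E \<times> UNIV) \<inter> space (F n))"
      using sets.sets_into_space[OF A] measurable_space[OF WF[of n]] by auto
    also have "\<dots> \<in> sets (F n)" by (rule sets.Int[OF A measurable_sets[OF WF]]) simp
    finally show ?thesis .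
  qed
  have evM: "{w \<in> A. W n w \<in> B} \<in> sets M" if "A \<in> sets (F n)" for A B n
    using subs evF[OF that] by blast
  have evM2: "{w \<in> A. W n w \<in> B \<and> W (Suc n) w \<in> B'} \<in> sets M" if "A \<in> sets (F n)" for A B B' n
    using evM[OF subsetD[OF FSuc evF[OF that, of B]], of B'] unfolding mem_Collect_eq conj_assoc .
  have two: "measure M {w \<in> A. X n w = x \<and> R w} =
      measure M {w \<in> A. W n w = (x, True) \<and> R w} + measure M {w \<in> A. W n w = (x, False) \<and> R w}"
    if "\<And>b. {w \<in> A. W n w \<in> {(x, b)} \<and> R w} \<in> sets M" for A n x R
  proof -
    have "{w \<in> A. X n w = x \<and> R w} =
        {w \<in> A. W n w = (x, True) \<and> R w} \<union> {w \<in> A. W n w = (x, False) \<and> R w}"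
      by (auto simp: X_def prod_eq_iff)
    moreover have "measure M \<dots> = measure M {w \<in> A. W n w = (x, True) \<and> R w} +
        measure M {w \<in> A. W n w = (x, False) \<and> R w}"
      by (rule finite_measure_Union) (use that[of True] that[of False] in auto)
    ultimately show ?thesis by simp
  qed
  have step: "measure M {w \<in> A. W n w = (x, b) \<and> W (Suc n) w = (y, b')} =
      measure M {w \<in> A. W n w = (x, b)} * (P x y * (if b' then c (Suc n) y else 1 - c (Suc n) y))"
    if "A \<in> sets (F n)" "x \<in> E" "y \<in> E" for A n x y b b'
    using that c01[OF \<open>y \<in> E\<close>, of "Suc n"] Q
    by (subst WS) (auto simp: K_def pmf_marked_pmf)
  have stepX: "measure M {w \<in> A. W n w = (x, b) \<and> X (Suc n) w = y} =
      measure M {w \<in> A. W n w = (x, b)} * P x y"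
    if "A \<in> sets (F n)" "x \<in> E" "y \<in> E" for A n x y b
  proof -
    have "measure M {w \<in> {w \<in> A. W n w = (x, b)}. X (Suc n) w = y \<and> True} =
        measure M {w \<in> {w \<in> A. W n w = (x, b)}. W (Suc n) w = (y, True) \<and> True} +
        measure M {w \<in> {w \<in> A. W n w = (x, b)}. W (Suc n) w = (y, False) \<and> True}"
    proof (rule two)
      show "{w \<in> {w \<in> A. W n w = (x, b)}. W (Suc n) w \<in> {(y, b')} \<and> True} \<in> sets M" for b'
        using evM2[OF that(1), of "{(x, b)}" "{(y, b')}"] by (simp only: mem_Collect_eq conj_assoc simp_thms singleton_iff)
    qed
    then show ?thesis
      using step[OF that] by (simp add: conj_assoc algebra_simps)
  qed
  have mc: "markov_chain E \<nu> P M F X"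
    unfolding markov_chain_def
  proof (intro conjI allI ballI)
    show "X n \<in> measurable (F n) (count_space E)" for n
      unfolding X_def by (rule measurable_compose[OF WF]) auto
    show "measure M {w \<in> space M. X 0 w = x} = \<nu> x" if x: "x \<in> E" for x
    proof -
      have "measure M {w \<in> space M. X 0 w = x \<and> True} =
          measure M {w \<in> space M. W 0 w = (x, True) \<and> True} +
          measure M {w \<in> space M. W 0 w = (x, False) \<and> True}"
      proof (rule two)
        show "{w \<in> space M. W 0 w \<in> {(x, b')} \<and> True} \<in> sets M" for b'
          using evM[OF sets.top[of "F 0"], of "{(x, b')}"] by (simp only: spF simp_thms)
      qed
      then show ?thesis
        using x q0 c01[OF x, of 0] by (simp add: W0 I_def pmf_marked_pmf algebra_simps)
    qed
    fix n A x y assume A: "A \<in> sets (F n)" and x: "x \<in> E" and y: "y \<in> E"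
    have "measure M {w \<in> A. X n w = x \<and> X (Suc n) w = y} =
        measure M {w \<in> A. W n w = (x, True) \<and> X (Suc n) w = y} +
        measure M {w \<in> A. W n w = (x, False) \<and> X (Suc n) w = y}"
    proof (rule two)
      fix b
      have "{w \<in> A. W n w \<in> {(x, b)} \<and> X (Suc n) w = y} =
          {w \<in> A. W n w \<in> {(x, b)} \<and> W (Suc n) w \<in> {y} \<times> UNIV}"
        by (auto simp: X_def mem_Times_iff)
      also have "\<dots> \<in> sets M" by (rule evM2[OF A])
      finally show "{w \<in> A. W n w \<in> {(x, b)} \<and> X (Suc n) w = y} \<in> sets M" .
    qed
    moreover have "measure M {w \<in> A. X n w = x \<and> True} =
        measure M {w \<in> A. W n w = (x, True) \<and> True} + measure M {w \<in> A. W n w = (x, False) \<and> True}"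
    proof (rule two)
      show "{w \<in> A. W n w \<in> {(x, b)} \<and> True} \<in> sets M" for b
        using evM[OF A, of "{(x, b)}"] by (simp only: simp_thms)
    qed
    ultimately show "measure M {w \<in> A. X n w = x \<and> X (Suc n) w = y} =
        measure M {w \<in> A. X n w = x} * P x y"
      using stepX[OF A x y] by (simp add: algebra_simps)
  qed (fact ps fil sub)+
  \<comment> \<open>No mark before time \<open>n\<close>; a mark at time \<open>n\<close> itself is still allowed.\<close>
  define N where "N n = {w \<in> space M. \<forall>k<n. \<not> Z k w}" for n
  have N_Suc: "N (Suc n) = {w \<in> N n. W n w \<in> UNIV \<times> {False}}" for n
    by (auto simp: N_def Z_def less_Suc_eq mem_Times_iff)
  have NF: "N n \<in> sets (F n)" for n
  proof (induction n)
    case 0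
    show ?case using sets.top[of "F 0"] by (simp add: N_def spF)
  next
    case (Suc n)
    then show ?case unfolding N_Suc using FSuc evF by blast
  qed
  have unmarked: "measure M {w \<in> N n. W n w = (y, b')} =
      (\<mu> n y - b n * \<pi> y) * (if b' then c n y else 1 - c n y)" if "y \<in> E" for n y b'
    using that
  proof (induction n arbitrary: y b')
    case 0
    then show ?case
      using q0 c01[OF 0, of 0] by (simp add: N_def W0 I_def pmf_marked_pmf \<mu>_def b_def)
  next
    case (Suc n)
    have ev: "{w \<in> N (Suc n). W (Suc n) w = (y, b')} \<in> sets M"
      using evM[OF NF, of "Suc n" "{(y, b')}"] by (simp only: singleton_iff)
    have IH: "measure M {w \<in> N n. W n w = (x, False)} = \<mu> n x - a n * \<pi> x" if "x \<in> E" for x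
      using Suc.IH[OF that, of False] c_mult[OF that, of n] by (simp add: algebra_simps)
    have "measure M {w \<in> N (Suc n). W (Suc n) w = (y, b')} =
        (\<Sum>x\<in>E. measure M {w \<in> {w \<in> N (Suc n). W (Suc n) w = (y, b')}. X n w = x})"
      by (rule markov_chain_sum_states[OF mc E ev])
    also have "\<dots> = (\<Sum>x\<in>E. measure M {w \<in> N n. W n w = (x, False) \<and> W (Suc n) w = (y, b')})"
    proof (rule sum.cong[OF refl])
      fix x
      have "{w \<in> {w \<in> N (Suc n). W (Suc n) w = (y, b')}. X n w = x} =
          {w \<in> N n. W n w = (x, False) \<and> W (Suc n) w = (y, b')}"
        unfolding N_Suc X_def by (auto simp: mem_Times_iff prod_eq_iff)
      then show "measure M {w \<in> {w \<in> N (Suc n). W (Suc n) w = (y, b')}. X n w = x} =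
          measure M {w \<in> N n. W n w = (x, False) \<and> W (Suc n) w = (y, b')}" by (rule arg_cong)
    qed
    also have "\<dots> = (\<Sum>x\<in>E. (\<mu> n x - a n * \<pi> x) *
        (P x y * (if b' then c (Suc n) y else 1 - c (Suc n) y)))"
      using step[OF NF _ Suc.prems] IH by (intro sum.cong) auto
    also have "\<dots> = ((\<Sum>x\<in>E. \<mu> n x * P x y) - a n * (\<Sum>x\<in>E. \<pi> x * P x y)) *
        (if b' then c (Suc n) y else 1 - c (Suc n) y)"
      by (simp only: sum_distrib_left sum_distrib_right sum_subtractf[symmetric])
         (intro sum.cong refl, simp add: algebra_simps)
    finally show ?case by (simp add: \<mu>_Suc \<pi>P[OF Suc.prems] b_def)
  qed
  have "\<exists>(M' :: (nat \<Rightarrow> 'e \<times> bool \<Rightarrow> 'e \<times> bool) measure) F' T.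
    strong_stationary_time E \<nu> P \<pi> M' F' X T \<and>
    (\<forall>n. measure M' {w \<in> space M'. T w \<le> n} = (\<Sum>k\<le>n. a k - b k))"
  proof (rule first_mark_strong_stationary_time[OF mc E stat, where Z=Z])
    show "Measurable.pred (F n) (Z n)" for n
      unfolding Z_def by (rule measurable_compose[OF WF]) auto
    show "measure M {w \<in> space M. (\<forall>k<n. \<not> Z k w) \<and> Z n w \<and> X n w = x} = (a n - b n) * \<pi> x"
      if "x \<in> E" for n x
    proof -
      have "{w \<in> space M. (\<forall>k<n. \<not> Z k w) \<and> Z n w \<and> X n w = x} = {w \<in> N n. W n w = (x, True)}"
        by (auto simp: N_def Z_def X_def prod_eq_iff)
      then show ?thesis using unmarked[OF that, of n True] c_mult[OF that, of n] by simp
    qed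
    show "measure M {w \<in> space M. \<exists>n. Z n w} = 1"
    proof -
      have prob_N: "measure M (N (Suc n)) = 1 - a n" for n
      proof -
        have "measure M (N (Suc n)) = (\<Sum>x\<in>E. measure M {w \<in> N (Suc n). X n w = x})"
          using subs NF by (intro markov_chain_sum_states[OF mc E]) blast
        also have "\<dots> = (\<Sum>x\<in>E. \<mu> n x - a n * \<pi> x)"
        proof (rule sum.cong[OF refl])
          fix x assume x: "x \<in> E"
          have "{w \<in> N (Suc n). X n w = x} = {w \<in> N n. W n w = (x, False)}"
            unfolding N_Suc X_def by (auto simp: mem_Times_iff prod_eq_iff)
          then show "measure M {w \<in> N (Suc n). X n w = x} = \<mu> n x - a n * \<pi> x"
            using unmarked[OF x, of n False] c_mult[OF x, of n] by (simp add: algebra_simps)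
        qed
        finally show ?thesis by (simp add: sum_subtractf \<mu>_sum sum_distrib_left[symmetric] \<pi>1)
      qed
      let ?G = "{w \<in> space M. \<exists>n. Z n w}"
      have "?G = (\<Union>n. space M - N (Suc n))" by (auto simp: N_def)
      also have "\<dots> \<in> sets M" using subs NF by (intro sets.countable_UN) blast
      finally have G: "?G \<in> sets M" .
      have compl_le: "1 - measure M ?G \<le> 1 - a n" for n
      proof -
        have "space M - ?G \<subseteq> N (Suc n)" by (auto simp: N_def)
        then have "measure M (space M - ?G) \<le> measure M (N (Suc n))"
          by (rule finite_measure_mono) (rule subsetD[OF subs NF])
        then show ?thesis unfolding prob_compl[OF G] prob_N .
      qed
      have "a n \<le> measure M ?G" for n using compl_le[of n] by linarith
      then have "1 \<le> measure M ?G" using LIMSEQ_le_const2[OF a_lim] by blast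
      with prob_le_1 show ?thesis by (rule antisym)
    qed
  qed
  moreover have "(\<Sum>k\<le>n. a k - b k) = a n" for n
    by (induction n) (auto simp: b_def)
  ultimately show ?thesis by auto
qed

text \<open>The state \<open>z\<close> attains the separation, so \<open>a n\<close> bounds \<open>P(T \<le> n)\<close> for every strong stationary time.
  The marking construction attains the bound; it is moved to the space of trajectories and times,
  on which fastest times are compared. Any other fastest time is squeezed between the two.\<close>

lemma fastest_strong_stationary_time_from_separation:
  fixes E :: "'e set" and a :: "nat \<Rightarrow> real"
  assumes E: "finite E"
    and P0: "\<And>x y. x \<in> E \<Longrightarrow> y \<in> E \<Longrightarrow> 0 \<le> P x y"
    and P1: "\<And>x. x \<in> E \<Longrightarrow> (\<Sum>y\<in>E. P x y) = 1"
    and \<nu>0: "\<And>x. x \<in> E \<Longrightarrow> 0 \<le> \<nu> x" and \<nu>1: "(\<Sum>x\<in>E. \<nu> x) = 1"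
    and stat: "stationary_distribution E P \<pi>"
    and a0: "0 \<le> a 0" and a_mono: "\<And>n. a n \<le> a (Suc n)" and a_lim: "a \<longlonglongrightarrow> 1"
    and a_le: "\<And>n y. y \<in> E \<Longrightarrow> a n * \<pi> y \<le> (evolve E P ^^ n) \<nu> y"
    and z: "z \<in> E" "0 < \<pi> z" and a_eq: "\<And>n. (evolve E P ^^ n) \<nu> z = a n * \<pi> z"
  shows "\<exists>(M :: ((nat \<Rightarrow> 'e) \<times> nat) measure) F X T.
      fastest_strong_stationary_time E \<nu> P \<pi> M F X T"
    and "fastest_strong_stationary_time E \<nu> P \<pi> (M' :: 'w measure) F' X' T' \<Longrightarrow>
      measure M' {w \<in> space M'. T' w \<le> n} = a n"
proof -
  have tail: "measure N {w \<in> space N. S w > k} = 1 - measure N {w \<in> space N. S w \<le> k}"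
    if "strong_stationary_time E \<nu> P \<pi> N G Y S" for N :: "'x measure" and G Y S k
  proof -
    interpret prob_space N using that by (auto simp: strong_stationary_time_def markov_chain_def)
    have "{w \<in> space N. S w \<le> k} \<in> sets N"
      using measurable_sets[OF strong_stationary_time_measurable[OF that], of "{..k}"]
      by (simp add: vimage_def Int_def conj_commute)
    moreover have "{w \<in> space N. S w > k} = space N - {w \<in> space N. S w \<le> k}" by auto
    ultimately show ?thesis using prob_compl by presburger
  qed
  have bound: "measure N {w \<in> space N. S w \<le> k} \<le> a k"
    if "strong_stationary_time E \<nu> P \<pi> N G Y S" for N :: "'x measure" and G Y S k
    using strong_stationary_time_cdf_le[OF that E z(1), of k] z(2) by (simp add: a_eq)
  obtain M0 :: "(nat \<Rightarrow> 'e \<times> bool \<Rightarrow> 'e \<times> bool) measure" and F0 X0 T0 where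
    s0: "strong_stationary_time E \<nu> P \<pi> M0 F0 X0 T0"
    and c0: "\<And>n. measure M0 {w \<in> space M0. T0 w \<le> n} = a n"
    using exists_strong_stationary_time[OF E P0 P1 \<nu>0 \<nu>1 stat a0 a_mono a_lim a_le] by blast
  obtain M1 :: "((nat \<Rightarrow> 'e) \<times> nat) measure" and F1 X1 T1 where
    s1: "strong_stationary_time E \<nu> P \<pi> M1 F1 X1 T1"
    and d1: "distr M1 (count_space UNIV) T1 = distr M0 (count_space UNIV) T0"
    using strong_stationary_time_canonical[OF s0] by blast
  have cdf: "measure N {w \<in> space N. S w \<le> k} = measure (distr N (count_space UNIV) S) {..k}"
    if "strong_stationary_time E \<nu> P \<pi> N G Y S" for N :: "'x measure" and G Y S k
    by (subst measure_distr[OF strong_stationary_time_measurable[OF that]])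
       (auto intro!: arg_cong[where f="measure N"])
  have c1: "measure M1 {w \<in> space M1. T1 w \<le> n} = a n" for n
    using cdf[OF s1] cdf[OF s0] c0 d1 by simp
  have "fastest_strong_stationary_time E \<nu> P \<pi> M1 F1 X1 T1"
    unfolding fastest_strong_stationary_time_def
    using s1 bound by (auto simp: tail[OF s1] c1 tail)
  then show "\<exists>(M :: ((nat \<Rightarrow> 'e) \<times> nat) measure) F X T.
      fastest_strong_stationary_time E \<nu> P \<pi> M F X T" by blast
  assume f: "fastest_strong_stationary_time E \<nu> P \<pi> M' F' X' T'"
  then have s: "strong_stationary_time E \<nu> P \<pi> M' F' X' T'"
    by (simp add: fastest_strong_stationary_time_def)
  from fastest_strong_stationary_time_le[OF f s0, of n] bound[OF s, of n]
  show "measure M' {w \<in> space M'. T' w \<le> n} = a n"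
    by (simp add: tail[OF s] tail[OF s0] c0)
qed

section \<open>Sums of independent geometric variables\<close>

text \<open>The distribution function of a sum of independent geometric variables with parameters
  \<open>p, 2p, \<dots>, mp\<close>, defined by its first-step recursion: the first trial of the variable with
  parameter \<open>mp\<close> succeeds or fails. This is the form in which the dual chains produce it; that it is
  indeed the law of the sum is lemma \<open>measure_sum_Geo_le\<close>.\<close>

fun geo_sum_cdf :: "real \<Rightarrow> nat \<Rightarrow> nat \<Rightarrow> real" where
  "geo_sum_cdf p 0 n = 1"
| "geo_sum_cdf p (Suc m) 0 = 0"
| "geo_sum_cdf p (Suc m) (Suc n) =
     real (Suc m) * p * geo_sum_cdf p m n + (1 - real (Suc m) * p) * geo_sum_cdf p (Suc m) n"

text \<open>For \<open>m = 0\<close> the coefficient of the meaningless term with \<open>m - 1\<close> vanishes.\<close>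

lemma geo_sum_cdf_Suc:
  "geo_sum_cdf p m (Suc n) =
     real m * p * geo_sum_cdf p (m - 1) n + (1 - real m * p) * geo_sum_cdf p m n"
  by (cases m) auto

lemma geo_sum_cdf_bounds:
  assumes "0 \<le> p" "real m * p \<le> 1"
  shows "0 \<le> geo_sum_cdf p m n" "geo_sum_cdf p m n \<le> 1"
proof -
  have "0 \<le> geo_sum_cdf p m n \<and> geo_sum_cdf p m n \<le> 1"
    using assms
  proof (induction p m n rule: geo_sum_cdf.induct)
    case (3 p m n)
    have "real m * p \<le> 1" using 3 by (simp add: algebra_simps)
    then have "0 \<le> geo_sum_cdf p m n" "geo_sum_cdf p m n \<le> 1"
        "0 \<le> geo_sum_cdf p (Suc m) n" "geo_sum_cdf p (Suc m) n \<le> 1"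
      using 3 by auto
    moreover have "0 \<le> real (Suc m) * p" "real (Suc m) * p \<le> 1" using 3 by auto
    ultimately show ?case
      unfolding geo_sum_cdf.simps
      by (intro conjI add_nonneg_nonneg convex_bound_le) (auto intro!: mult_nonneg_nonneg)
  qed auto
  then show "0 \<le> geo_sum_cdf p m n" "geo_sum_cdf p m n \<le> 1" by auto
qed

lemma geo_sum_cdf_mono:
  assumes "0 \<le> p" "real m * p \<le> 1"
  shows "geo_sum_cdf p m n \<le> geo_sum_cdf p m (Suc n)"
  using assms
proof (induction p m n rule: geo_sum_cdf.induct)
  case (2 p m)
  then show ?case using geo_sum_cdf_bounds[of p "Suc m" 1] by simp
next
  case (3 p m n)
  have "real m * p \<le> 1" using 3 by (simp add: algebra_simps)
  then have "geo_sum_cdf p m n \<le> geo_sum_cdf p m (Suc n)"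
      "geo_sum_cdf p (Suc m) n \<le> geo_sum_cdf p (Suc m) (Suc n)"
    using 3 by auto
  moreover have "0 \<le> real (Suc m) * p" "0 \<le> 1 - real (Suc m) * p" using 3 by auto
  ultimately show ?case
    unfolding geo_sum_cdf.simps(3)[of p m "Suc n"]
    by (subst geo_sum_cdf.simps(3)) (intro add_mono mult_left_mono)
qed auto

text \<open>The limit \<open>L\<close> exists by monotonicity. Passing to the limit in the recursion, where the term for \<open>m\<close>
  tends to \<open>1\<close>, forces \<open>L = 1\<close> because \<open>(m + 1) p > 0\<close>.\<close>

lemma geo_sum_cdf_tendsto:
  assumes "0 < p" "real m * p \<le> 1"
  shows "geo_sum_cdf p m \<longlonglongrightarrow> 1"
  using assms(2)
proof (induction m)
  case 0
  then show ?case by simp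
next
  case (Suc m)
  have "incseq (geo_sum_cdf p (Suc m))"
    by (intro incseq_SucI geo_sum_cdf_mono) (use assms Suc in auto)
  then obtain L where L: "geo_sum_cdf p (Suc m) \<longlonglongrightarrow> L"
    by (rule incseq_convergent[of _ 1]) (use geo_sum_cdf_bounds(2)[of p "Suc m"] assms Suc in auto)
  have "geo_sum_cdf p m \<longlonglongrightarrow> 1" using Suc assms by (simp add: algebra_simps)
  then have "(\<lambda>n. geo_sum_cdf p (Suc m) (Suc n)) \<longlonglongrightarrow>
      real (Suc m) * p * 1 + (1 - real (Suc m) * p) * L"
    unfolding geo_sum_cdf.simps using L by (intro tendsto_intros)
  with LIMSEQ_Suc[OF L] have "L = real (Suc m) * p * 1 + (1 - real (Suc m) * p) * L"
    by (rule LIMSEQ_unique)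
  then have "real (Suc m) * p * (L - 1) = 0" by (simp add: algebra_simps)
  then have "L = 1" using assms by auto
  with L show ?case by simp
qed

text \<open>Memorylessness makes the convolution satisfy the recursion: its term for \<open>j = 1\<close> is the success of the
  first trial, and the remaining terms are \<open>1 - q\<close> times the convolution at the previous time.\<close>

lemma geo_sum_cdf_convolution:
  assumes "0 < p" "real (Suc m) * p \<le> 1"
  shows "geo_sum_cdf p (Suc m) n = (\<Sum>j\<le>n. pmf (Geo (real (Suc m) * p)) j * geo_sum_cdf p m (n - j))"
proof (induction n)
  define q where "q = real (Suc m) * p"
  have q: "0 < q" "q \<le> 1" using assms by (auto simp: q_def)
  have Geo0: "pmf (Geo q) 0 = 0" by (simp add: Geo_def pmf_eq_0_set_pmf)
  {
    case 0
    then show ?case using Geo0 by (simp add: q_def)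
  next
    case (Suc n)
    have "(\<Sum>j\<le>Suc n. pmf (Geo q) j * geo_sum_cdf p m (Suc n - j)) =
        (\<Sum>j\<le>n. pmf (Geo q) (Suc j) * geo_sum_cdf p m (n - j))"
      by (subst sum.atMost_Suc_shift) (simp add: Geo0)
    also have "\<dots> = q * geo_sum_cdf p m n + (1 - q) * (\<Sum>j\<le>n. pmf (Geo q) j * geo_sum_cdf p m (n - j))"
    proof (cases n)
      case 0
      then show ?thesis using q by (simp add: pmf_Geo Geo0)
    next
      case (Suc k)
      have "pmf (Geo q) (Suc (Suc j)) = (1 - q) * pmf (Geo q) (Suc j)" for j
        using q by (simp add: pmf_Geo)
      then show ?thesis
        unfolding Suc using q
        by (subst (1 2) sum.atMost_Suc_shift) (simp add: pmf_Geo Geo0 sum_distrib_left mult.assoc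
            mult.left_commute[of "1 - q"])
    qed
    finally show ?case using Suc by (simp add: q_def)
  }
qed

lemma measure_sum_Geo_le:
  fixes X :: "nat \<Rightarrow> 'c \<Rightarrow> nat"
  assumes N: "prob_space N" and indep: "prob_space.indep_vars N (\<lambda>_. count_space UNIV) X {1..m}"
    and X: "\<And>k. k \<in> {1..m} \<Longrightarrow> distr N (count_space UNIV) (X k) = measure_pmf (Geo (real k * p))"
    and p: "0 < p" "real m * p \<le> 1"
  shows "measure N {w \<in> space N. (\<Sum>k = 1..m. X k w) \<le> n} = geo_sum_cdf p m n"
  using indep X p(2)
proof (induction m arbitrary: n)
  interpret prob_space N by (rule N)
  {
    case 0
    then show ?case by (simp add: prob_space)
  next
    case (Suc m)
    let ?S = "\<lambda>w. \<Sum>k = 1..m. X k w" and ?C = "\<lambda>_::nat. count_space (UNIV :: nat set)"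
    have rv: "X k \<in> measurable N (count_space UNIV)" if "k \<in> {1..Suc m}" for k
      using Suc.prems(1) that unfolding indep_vars_def2 by blast
    have IH: "measure N {w \<in> space N. ?S w \<le> k} = geo_sum_cdf p m k" for k
      using Suc.prems p by (intro Suc.IH indep_vars_subset[OF Suc.prems(1)]) (auto simp: algebra_simps)
    have ind: "indep_var (PiM {Suc m} ?C) (\<lambda>w. restrict (\<lambda>i. X i w) {Suc m})
        (PiM {1..m} ?C) (\<lambda>w. restrict (\<lambda>i. X i w) {1..m})"
      by (rule indep_var_restrict[OF Suc.prems(1)]) auto
    have sum_meas: "(\<lambda>x. \<Sum>i = 1..m. x i) \<in> measurable (PiM {1..m} ?C) (count_space UNIV)"
    proof -
      have "(\<lambda>x. x i) \<in> borel_measurable (PiM {1..m} ?C)" if "i \<in> {1..m}" for i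
        by (rule measurable_compose[OF measurable_component_singleton[OF that]]) simp
      then have "(\<lambda>x. \<Sum>i = 1..m. x i) \<in> borel_measurable (PiM {1..m} ?C)"
        by (rule borel_measurable_sum)
      then show ?thesis using measurable_cong_sets[OF refl sets_borel_eq_count_space] by blast
    qed
    have prod: "measure N {w \<in> space N. X (Suc m) w = j \<and> ?S w \<le> k} =
        pmf (Geo (real (Suc m) * p)) j * geo_sum_cdf p m k" for j k
    proof -
      let ?A = "(\<lambda>x. x (Suc m)) -` {j} \<inter> space (PiM {Suc m} ?C)"
      let ?B = "(\<lambda>x. \<Sum>i = 1..m. x i) -` {..k} \<inter> space (PiM {1..m} ?C)"
      have A: "?A \<in> sets (PiM {Suc m} ?C)"
        by (rule measurable_sets[OF measurable_component_singleton]) auto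
      have B: "?B \<in> sets (PiM {1..m} ?C)"
        by (rule measurable_sets[OF sum_meas]) auto
      have "measure N {w \<in> space N. X (Suc m) w = j \<and> ?S w \<le> k} =
          measure N ((\<lambda>w. (restrict (\<lambda>i. X i w) {Suc m}, restrict (\<lambda>i. X i w) {1..m})) -`
            (?A \<times> ?B) \<inter> space N)"
        by (rule arg_cong[where f="measure N"]) (auto simp: space_PiM)
      also have "\<dots> = measure N ((\<lambda>w. restrict (\<lambda>i. X i w) {Suc m}) -` ?A \<inter> space N) *
          measure N ((\<lambda>w. restrict (\<lambda>i. X i w) {1..m}) -` ?B \<inter> space N)"
        by (rule indep_varD[OF ind A B])
      also have "(\<lambda>w. restrict (\<lambda>i. X i w) {Suc m}) -` ?A \<inter> space N = X (Suc m) -` {j} \<inter> space N"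
        by (auto simp: space_PiM)
      also have "(\<lambda>w. restrict (\<lambda>i. X i w) {1..m}) -` ?B \<inter> space N = {w \<in> space N. ?S w \<le> k}"
        by (auto simp: space_PiM)
      also have "measure N (X (Suc m) -` {j} \<inter> space N) =
          measure (distr N (count_space UNIV) (X (Suc m))) {j}"
        by (rule measure_distr[symmetric]) (use rv in auto)
      also have "\<dots> = pmf (Geo (real (Suc m) * p)) j"
        using Suc.prems(2)[of "Suc m"] by (simp add: measure_pmf_single)
      finally show ?thesis by (simp only: IH)
    qed
    have sets: "{w \<in> space N. X (Suc m) w = j \<and> ?S w \<le> k} \<in> sets N" for j k
    proof -
      have "(\<lambda>w. restrict (\<lambda>i. X i w) {1..m}) \<in> measurable N (PiM {1..m} ?C)"
        by (rule measurable_restrict) (use rv in auto)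
      from measurable_compose[OF this sum_meas]
      have "?S \<in> measurable N (count_space UNIV)" by simp
      from measurable_sets[OF this, of "{..k}"] measurable_sets[OF rv, of "Suc m" "{j}"]
      have "?S -` {..k} \<inter> space N \<in> sets N" "X (Suc m) -` {j} \<inter> space N \<in> sets N"
        by simp_all
      then have "(X (Suc m) -` {j} \<inter> space N) \<inter> (?S -` {..k} \<inter> space N) \<in> sets N"
        by (rule sets.Int[rotated])
      also have "(X (Suc m) -` {j} \<inter> space N) \<inter> (?S -` {..k} \<inter> space N) =
          {w \<in> space N. X (Suc m) w = j \<and> ?S w \<le> k}" by auto
      finally show ?thesis .
    qed
    have "{w \<in> space N. (\<Sum>k = 1..Suc m. X k w) \<le> n} =
        (\<Union>j\<in>{..n}. {w \<in> space N. X (Suc m) w = j \<and> ?S w \<le> n - j})" by auto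
    then have "measure N {w \<in> space N. (\<Sum>k = 1..Suc m. X k w) \<le> n} =
        measure N (\<Union>j\<in>{..n}. {w \<in> space N. X (Suc m) w = j \<and> ?S w \<le> n - j})" by (rule arg_cong)
    also have "\<dots> = (\<Sum>j\<le>n. measure N {w \<in> space N. X (Suc m) w = j \<and> ?S w \<le> n - j})"
    proof (rule finite_measure_finite_Union)
      show "(\<lambda>j. {w \<in> space N. X (Suc m) w = j \<and> ?S w \<le> n - j}) ` {..n} \<subseteq> sets N"
        using sets by blast
    qed (auto simp: disjoint_family_on_def)
    finally show ?case
      using geo_sum_cdf_convolution[OF p(1) Suc.prems(3)] by (simp only: prod)
  }
qed


lemma distr_nat_eqI:
  fixes T1 :: "'a \<Rightarrow> nat" and T2 :: "'b \<Rightarrow> nat"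
  assumes M: "prob_space M1" "prob_space M2"
    and T: "T1 \<in> measurable M1 (count_space UNIV)" "T2 \<in> measurable M2 (count_space UNIV)"
    and le: "\<And>n. measure M1 {w \<in> space M1. T1 w \<le> n} = measure M2 {w \<in> space M2. T2 w \<le> n}"
  shows "distr M1 (count_space UNIV) T1 = distr M2 (count_space UNIV) T2"
proof (rule measure_eqI_countable[where A=UNIV])
  let ?D1 = "distr M1 (count_space UNIV) T1" and ?D2 = "distr M2 (count_space UNIV) T2"
  interpret D1: prob_space ?D1 by (rule prob_space.prob_space_distr[OF M(1) T(1)])
  interpret D2: prob_space ?D2 by (rule prob_space.prob_space_distr[OF M(2) T(2)])
  have cdf: "measure ?D1 {..n} = measure ?D2 {..n}" for n
    using le[of n] by (simp add: measure_distr T vimage_def Int_def conj_commute)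
  have point: "measure D {n} = measure D {..n} - (case n of 0 \<Rightarrow> 0 | Suc m \<Rightarrow> measure D {..m})"
    if "prob_space D" "sets D = UNIV" for D :: "nat measure" and n
  proof -
    interpret prob_space D by fact
    have "{..Suc m} - {..m} = {Suc m}" for m by auto
    then show ?thesis
      using that finite_measure_Diff[of "{..n}" "case n of 0 \<Rightarrow> {} | Suc m \<Rightarrow> {..m}"]
      by (cases n) auto
  qed
  show "emeasure ?D1 {n} = emeasure ?D2 {n}" for n
    using point[OF D1.prob_space_axioms, of n] point[OF D2.prob_space_axioms, of n]
    by (simp add: D1.emeasure_eq_measure D2.emeasure_eq_measure cdf split: nat.split)
qed auto


section \<open>Ranked dual chains\<close>

lemma evolve_pow_cong:
  assumes "\<And>x. x \<in> E \<Longrightarrow> u x = v x" and "y \<in> E"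
  shows "(evolve E P ^^ n) u y = (evolve E P ^^ n) v y"
  using assms(2)
proof (induction n arbitrary: y)
  case (Suc n)
  then show ?case by (auto simp: evolve_def intro!: sum.cong)
qed (simp add: assms(1))

text \<open>Linearity, for combinations of the shape in which a dual chain moves: to one of the members indexed
  by \<open>J\<close>, or nowhere.\<close>

lemma evolve_pow_combination:
  "(evolve E P ^^ n) (\<lambda>x. (\<Sum>j\<in>J. w j * u j x) + c * v x) y =
     (\<Sum>j\<in>J. w j * (evolve E P ^^ n) (u j) y) + c * (evolve E P ^^ n) v y"
proof (induction n arbitrary: y)
  case (Suc n)
  have "(\<Sum>x\<in>E. (\<Sum>j\<in>J. w j * (evolve E P ^^ n) (u j) x) * P x y) =
      (\<Sum>j\<in>J. w j * (\<Sum>x\<in>E. (evolve E P ^^ n) (u j) x * P x y))"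
    unfolding sum_distrib_left sum_distrib_right mult.assoc by (rule sum.swap)
  then show ?case
    by (simp add: evolve_def[of _ _ "(evolve E P ^^ n) _"] Suc.IH ring_distribs sum.distrib sum_distrib_left mult.assoc)
qed simp

text \<open>The distributions \<open>u i\<close> on \<open>E\<close> are the link between the chain and a dual chain on \<open>I\<close>. From \<open>i\<close> the
  dual moves to each element of \<open>J i\<close> with the same probability \<open>q i\<close>. The rank counts the moves
  still needed to reach \<open>\<pi>\<close>, and the total rate of moving is the rank times \<open>p\<close>, as for a coupon
  collector. Only the rank of the dual matters in the end, which is why chains on very different
  state spaces share the law of their fastest strong stationary times.\<close>

locale ranked_dual_chain =
  fixes E :: "'e set" and P :: "'e \<Rightarrow> 'e \<Rightarrow> real" and \<pi> :: "'e \<Rightarrow> real" and p :: real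
    and I :: "'i set" and u :: "'i \<Rightarrow> 'e \<Rightarrow> real" and J :: "'i \<Rightarrow> 'i set" and q :: "'i \<Rightarrow> real"
    and r :: "'i \<Rightarrow> nat"
  assumes step: "\<And>i y. i \<in> I \<Longrightarrow> y \<in> E \<Longrightarrow>
      evolve E P (u i) y = (\<Sum>j\<in>J i. q i * u j y) + (1 - real (r i) * p) * u i y"
    and J_subset: "\<And>i. i \<in> I \<Longrightarrow> J i \<subseteq> I"
    and rank_J: "\<And>i j. i \<in> I \<Longrightarrow> j \<in> J i \<Longrightarrow> r j = r i - 1"
    and rate: "\<And>i. i \<in> I \<Longrightarrow> real (card (J i)) * q i = real (r i) * p"
    and rate_nonneg: "\<And>i. i \<in> I \<Longrightarrow> 0 \<le> q i"
    and rate_le_1: "\<And>i. i \<in> I \<Longrightarrow> real (r i) * p \<le> 1"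
    and u_nonneg: "\<And>i y. i \<in> I \<Longrightarrow> y \<in> E \<Longrightarrow> 0 \<le> u i y"
    and u_final: "\<And>i y. i \<in> I \<Longrightarrow> r i = 0 \<Longrightarrow> y \<in> E \<Longrightarrow> u i y = \<pi> y"
begin

text \<open>First-step analysis of the dual chain: the first of the \<open>n + 1\<close> steps is taken by the dual instead of
  the chain.\<close>

lemma evolve_pow_Suc_dual:
  assumes "i \<in> I" "y \<in> E"
  shows "(evolve E P ^^ Suc n) (u i) y =
    (\<Sum>j\<in>J i. q i * (evolve E P ^^ n) (u j) y) + (1 - real (r i) * p) * (evolve E P ^^ n) (u i) y"
proof -
  have "(evolve E P ^^ Suc n) (u i) y = (evolve E P ^^ n) (evolve E P (u i)) y"
    by (simp add: funpow_swap1)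
  also have "\<dots> = (evolve E P ^^ n)
      (\<lambda>x. (\<Sum>j\<in>J i. q i * u j x) + (1 - real (r i) * p) * u i x) y"
    by (rule evolve_pow_cong) (use step assms in auto)
  finally show ?thesis by (simp only: evolve_pow_combination)
qed

text \<open>The same first-step recursion for the distribution function of the absorption time of the dual,
  written over the elements of \<open>J i\<close> to be compared term by term.\<close>

lemma geo_sum_cdf_Suc_dual:
  assumes "i \<in> I"
  shows "geo_sum_cdf p (r i) (Suc n) * c =
    (\<Sum>j\<in>J i. q i * (geo_sum_cdf p (r j) n * c)) + (1 - real (r i) * p) * (geo_sum_cdf p (r i) n * c)"
proof -
  have "(\<Sum>j\<in>J i. q i * (geo_sum_cdf p (r j) n * c)) =
      (\<Sum>j\<in>J i. q i * (geo_sum_cdf p (r i - 1) n * c))"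
    by (rule sum.cong) (use rank_J assms in auto)
  also have "\<dots> = real (r i) * p * (geo_sum_cdf p (r i - 1) n * c)"
    using rate[OF assms] by (simp add: mult.assoc[symmetric])
  finally show ?thesis by (simp add: geo_sum_cdf_Suc ring_distribs mult.assoc)
qed

text \<open>With probability \<open>geo_sum_cdf p (r i) n\<close> the dual has reached rank \<open>0\<close> by time \<open>n\<close>, and then the
  chain has law \<open>\<pi>\<close>; the rest of its law is nonnegative.\<close>

lemma evolve_pow_ge:
  assumes "i \<in> I" "y \<in> E"
  shows "geo_sum_cdf p (r i) n * \<pi> y \<le> (evolve E P ^^ n) (u i) y"
  using assms(1)
proof (induction n arbitrary: i)
  case 0
  then show ?case
    using u_final[OF 0 _ assms(2)] u_nonneg[OF 0 assms(2)] by (cases "r i") auto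
next
  case (Suc n)
  show ?case
    unfolding evolve_pow_Suc_dual[OF Suc.prems assms(2)] geo_sum_cdf_Suc_dual[OF Suc.prems]
    using Suc J_subset rate_nonneg rate_le_1
    by (intro add_mono sum_mono mult_left_mono) auto
qed

text \<open>A state that no distribution of positive rank charges receives mass only after the dual is absorbed.\<close>

lemma evolve_pow_eq:
  assumes "i \<in> I" "z \<in> E" and miss: "\<And>i. i \<in> I \<Longrightarrow> r i \<noteq> 0 \<Longrightarrow> u i z = 0"
  shows "(evolve E P ^^ n) (u i) z = geo_sum_cdf p (r i) n * \<pi> z"
  using assms(1)
proof (induction n arbitrary: i)
  case 0
  then show ?case
    using u_final[OF 0 _ assms(2)] miss[OF 0] by (cases "r i") auto
next
  case (Suc n)
  show ?case
    unfolding evolve_pow_Suc_dual[OF Suc.prems assms(2)] geo_sum_cdf_Suc_dual[OF Suc.prems]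
    using Suc J_subset by (intro arg_cong2[where f="(+)"] sum.cong) auto
qed

end

context ranked_dual_chain
begin

text \<open>At rank \<open>0\<close> the dual does not move, so the corresponding distribution is invariant.\<close>

lemma stationary_distribution_final:
  assumes i: "i \<in> I" "r i = 0" and sum: "(\<Sum>x\<in>E. \<pi> x) = 1"
  shows "stationary_distribution E P \<pi>"
  unfolding stationary_distribution_def
proof (intro conjI ballI)
  show "0 \<le> \<pi> x" if "x \<in> E" for x
    using u_nonneg[OF i(1) that] u_final[OF i that] by simp
  show "(\<Sum>x\<in>E. \<pi> x * P x y) = \<pi> y" if y: "y \<in> E" for y
  proof -
    have "card (J i) = 0 \<or> q i = 0" using rate[OF i(1)] i by simp
    then have no_exit: "(\<Sum>j\<in>J i. q i * u j y) = 0" by (auto simp: card_eq_0_iff)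
    have "(\<Sum>x\<in>E. \<pi> x * P x y) = evolve E P (u i) y"
      unfolding evolve_def by (rule sum.cong) (simp_all add: u_final[OF i])
    then show ?thesis using step[OF i(1) y] no_exit u_final[OF i y] i by simp
  qed
qed (rule sum)

lemma fastest_strong_stationary_time_dual:
  assumes E: "finite E"
    and P0: "\<And>x y. x \<in> E \<Longrightarrow> y \<in> E \<Longrightarrow> 0 \<le> P x y"
    and P1: "\<And>x. x \<in> E \<Longrightarrow> (\<Sum>y\<in>E. P x y) = 1"
    and stat: "stationary_distribution E P \<pi>"
    and p: "0 < p"
    and i: "i \<in> I" and \<nu>: "\<And>x. x \<in> E \<Longrightarrow> \<nu> x = u i x" and \<nu>1: "(\<Sum>x\<in>E. \<nu> x) = 1"
    and z: "z \<in> E" "0 < \<pi> z" and miss: "\<And>j. j \<in> I \<Longrightarrow> r j \<noteq> 0 \<Longrightarrow> u j z = 0"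
  shows "\<exists>(M :: ((nat \<Rightarrow> 'e) \<times> nat) measure) F X T.
      fastest_strong_stationary_time E \<nu> P \<pi> M F X T"
    and "fastest_strong_stationary_time E \<nu> P \<pi> (M' :: 'w measure) F' X' T' \<Longrightarrow>
      measure M' {w \<in> space M'. T' w \<le> n} = geo_sum_cdf p (r i) n"
proof -
  have \<nu>_pow: "(evolve E P ^^ k) \<nu> y = (evolve E P ^^ k) (u i) y" if "y \<in> E" for k y
    using \<nu> that by (rule evolve_pow_cong)
  note separation = fastest_strong_stationary_time_from_separation[OF E P0 P1 _ \<nu>1 stat
      geo_sum_cdf_bounds(1) geo_sum_cdf_mono geo_sum_cdf_tendsto _ z]
  note hyps = \<nu> u_nonneg[OF i] \<nu>_pow evolve_pow_ge[OF i] evolve_pow_eq[OF i z(1) miss] p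
    rate_le_1[OF i] z(1)
  show "\<exists>(M :: ((nat \<Rightarrow> 'e) \<times> nat) measure) F X T.
      fastest_strong_stationary_time E \<nu> P \<pi> M F X T"
    by (rule separation(1)[of p "r i"]) (use hyps in auto)
  show "measure M' {w \<in> space M'. T' w \<le> n} = geo_sum_cdf p (r i) n"
    if "fastest_strong_stationary_time E \<nu> P \<pi> (M' :: 'w measure) F' X' T'"
    by (rule separation(2)[OF _ _ _ _ _ _ _ _ _ _ _ _ that]) (use hyps in auto)
qed

end


section \<open>The chain on an interval\<close>

definition uniform_upto :: "nat \<Rightarrow> nat \<Rightarrow> real" where
  "uniform_upto m x = (if x \<le> m then 1 / real m else 0)"

text \<open>These sums are \<open>m\<close> times \<open>u\<^sub>m P\<close>, with \<open>u\<^sub>m\<close> uniform on \<open>{1,\<dots>,m}\<close>. The induction over \<open>m\<close> works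
  because the entries of column \<open>y\<close> below the diagonal telescope: up to the factor \<open>(d + 1) p\<close> they
  are \<open>1/k - 1/(k + 1)\<close>. Row \<open>d\<close> has entries of a different form, so the last step is separate.\<close>

lemma P1_column_sum:
  assumes d: "d > 1" and m: "1 \<le> m" "m \<le> d" and y: "y \<in> E1 d"
  shows "(\<Sum>x = 1..m. P1 d p x y) =
    (if y \<le> m then 1 - (real d - real m) * p / (real m + 1)
     else if y = Suc m then (real d - real m) * p * real m / (real m + 1) else 0)"
  using m
proof (induction m rule: dec_induct)
  case base
  then show ?case using d y by (auto simp: P1_def E1_def)
next
  case (step m)
  have sum: "(\<Sum>x = 1..Suc m. P1 d p x y) = (\<Sum>x = 1..m. P1 d p x y) + P1 d p (Suc m) y"
    by simp
  have pos: "real m + 1 \<noteq> 0" "real m + 2 \<noteq> 0" by auto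
  show ?case
  proof (cases "Suc m = d")
    case True
    then have d_eq: "real d = real m + 1" by simp
    have last: "P1 d p (Suc m) y = (if y \<le> m then p / real d else p / real d + 1 - p)"
      using True y d by (auto simp: P1_def E1_def)
    have "0 < 1 + (real m * real m + real m * 2)" by (simp add: add_pos_nonneg)
    then show ?thesis
      unfolding sum last using step y True by (auto simp: E1_def d_eq field_simps)
  next
    case False
    define a D where "a = real m + 1" and "D = real d"
    have a: "a > 0" "real m = a - 1" "real (Suc m) = a" by (simp_all add: a_def)
    have next_column: "P1 d p (Suc m) y =
        (if y \<le> m then (D + 1) / (a * (a + 1)) * p
         else if y = Suc m then 1 - ((D - a) / (a + 1) + (D - a + 1) * (a - 1) / a) * p
         else if y = Suc (Suc m) then (D - a) * p * (a / (a + 1)) else 0)"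
    proof -
      have "1 < Suc m" "Suc m < d" using step.hyps(1) step.prems False by auto
      then show ?thesis unfolding P1_def a(3) D_def by auto
    qed
    have "(D - (a - 1)) * p / a - (D + 1) / (a * (a + 1)) * p = (D - a) * p / (a + 1)"
      using a(1) by (simp add: divide_simps) (simp add: algebra_simps)
    moreover have "(\<Sum>x = 1..m. P1 d p x y) =
        (if y \<le> m then 1 - (D - (a - 1)) * p / a
         else if y = Suc m then (D - (a - 1)) * p * (a - 1) / a else 0)"
      using step by (simp add: a(2) D_def)
    ultimately show ?thesis
      unfolding sum next_column a(3) D_def[symmetric]
      by (auto simp: algebra_simps add_divide_distrib diff_divide_distrib)
  qed
qed

lemma P1_row_sum:
  assumes d: "d > 1" and k: "k \<in> E1 d"
  shows "(\<Sum>s\<in>E1 d. P1 d p k s) = 1"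
proof -
  consider "k = 1" | "1 < k" "k < d" | "k = d" "1 < d" using k d by (auto simp: E1_def) linarith
  then show ?thesis
  proof cases
    case 1
    have "(\<Sum>s\<in>E1 d. P1 d p k s) = (\<Sum>s\<in>{1, 2}. P1 d p k s)"
      by (rule sum.mono_neutral_right) (use 1 d in \<open>auto simp: P1_def E1_def\<close>)
    also have "\<dots> = 1" using 1 d by (simp add: P1_def)
    finally show ?thesis .
  next
    case 2
    have "(\<Sum>s\<in>E1 d. P1 d p k s) = (\<Sum>s\<in>{1..<k} \<union> {k, k + 1}. P1 d p k s)"
      by (rule sum.mono_neutral_right) (use 2 in \<open>auto simp: P1_def E1_def\<close>)
    also have "\<dots> = (\<Sum>s = 1..<k. P1 d p k s) + (P1 d p k k + P1 d p k (k + 1))"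
      by (subst sum.union_disjoint) auto
    also have "(\<Sum>s = 1..<k. P1 d p k s) =
        (\<Sum>s = 1..<k. (real d + 1) / (real k * (real k + 1)) * p)"
      by (rule sum.cong) (use 2 in \<open>auto simp: P1_def\<close>)
    also have "\<dots> = (real k - 1) * ((real d + 1) / (real k * (real k + 1)) * p)"
      using 2 by (simp add: of_nat_diff)
    also have "P1 d p k k =
        1 - ((real d - real k) / (real k + 1) + (real d - real k + 1) * (real k - 1) / real k) * p"
      using 2 by (simp add: P1_def)
    also have "P1 d p k (k + 1) = (real d - real k) * p * (real k / (real k + 1))"
      using 2 by (simp add: P1_def)
    also have "(real k - 1) * ((real d + 1) / (real k * (real k + 1)) * p) +
        (1 - ((real d - real k) / (real k + 1) + (real d - real k + 1) * (real k - 1) / real k) * p +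
         (real d - real k) * p * (real k / (real k + 1))) = 1"
    proof -
      define K where "K = real k"
      have "K > 0" using 2 by (simp add: K_def)
      then show ?thesis
        unfolding K_def[symmetric] by (simp add: divide_simps) (simp add: algebra_simps)
    qed
    finally show ?thesis .
  next
    case 3
    have "E1 d = insert d {1..<d}" using 3 by (auto simp: E1_def)
    moreover have "(\<Sum>s = 1..<d. P1 d p k s) = (\<Sum>s = 1..<d. p / real d)"
      by (rule sum.cong) (use 3 in \<open>auto simp: P1_def\<close>)
    ultimately show ?thesis using 3 by (simp add: P1_def of_nat_diff) (simp add: field_simps)
  qed
qed

lemma P1_nonneg:
  assumes d: "d > 1" and p: "0 < p" "real d * p \<le> 1" and k: "k \<in> E1 d" "s \<in> E1 d"
  shows "0 \<le> P1 d p k s"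
proof -
  have first: "1 / 2 * (real d - 1) * p \<le> 1" using p d by (simp add: algebra_simps)
  have diag: "((real d - real k) / (real k + 1) + (real d - real k + 1) * (real k - 1) / real k) * p \<le> 1"
    if "1 < k" "k < d"
  proof -
    have "(real d - real k) / (real k + 1) \<le> (real d - real k) / real k"
      using that by (intro divide_left_mono) auto
    also have "\<dots> + (real d - real k + 1) * (real k - 1) / real k = real d - real k + 1 - 1 / real k"
      using that by (simp add: field_simps)
    finally have "(real d - real k) / (real k + 1) + (real d - real k + 1) * (real k - 1) / real k \<le> real d"
      using that by (smt (verit) of_nat_1 of_nat_less_iff zero_le_divide_1_iff)
    then have "((real d - real k) / (real k + 1) + (real d - real k + 1) * (real k - 1) / real k) * p
        \<le> real d * p" using p by (intro mult_right_mono) auto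
    with p show ?thesis by linarith
  qed
  have "1 * p \<le> real d * p" using p d by (intro mult_right_mono) auto
  with p have "p \<le> 1" by linarith
  moreover have "0 \<le> p / real d" using p by simp
  ultimately have last: "p \<le> p / real d + 1" by linarith
  show ?thesis
    using first diag last p d by (auto simp: P1_def)
qed

text \<open>The uniform distribution on \<open>{1,\<dots>,m}\<close> moves to the one on \<open>{1,\<dots>,m+1}\<close> at rate \<open>(d - m) p\<close>.\<close>

lemma evolve_uniform_upto:
  assumes d: "d > 1" and m: "m \<in> {1..d}" and y: "y \<in> E1 d"
  shows "evolve (E1 d) (P1 d p) (uniform_upto m) y =
    (\<Sum>j\<in>(if m < d then {Suc m} else {}). (real d - real m) * p * uniform_upto j y) +
    (1 - real (d - m) * p) * uniform_upto m y"
proof -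
  have "evolve (E1 d) (P1 d p) (uniform_upto m) y = (\<Sum>x = 1..m. uniform_upto m x * P1 d p x y)"
    unfolding evolve_def
    by (rule sum.mono_neutral_right) (use m in \<open>auto simp: E1_def uniform_upto_def\<close>)
  also have "\<dots> = (\<Sum>x = 1..m. P1 d p x y) / real m"
    by (simp add: uniform_upto_def sum_divide_distrib)
  also have "\<dots> = (if y \<le> m then 1 - (real d - real m) * p / (real m + 1)
     else if y = Suc m then (real d - real m) * p * real m / (real m + 1) else 0) / real m"
    using P1_column_sum[OF d, of m y p] m y by simp
  finally have lhs: "evolve (E1 d) (P1 d p) (uniform_upto m) y = \<dots>" .
  define M R where "M = real m" and "R = (real d - real m) * p"
  have M: "0 < M" using m by (simp add: M_def)
  have rate: "(real d - M) * p = R" by (simp add: R_def M_def)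
  have R: "real (d - m) * p = R" using m by (simp add: R_def of_nat_diff)
  have "(1 - R / (M + 1)) / M = R / (M + 1) + (1 - R) / M"
    using M by (simp add: divide_simps) (simp add: algebra_simps)
  moreover have "R * M / (M + 1) / M = R / (M + 1)" using M by simp
  moreover have "R = 0" if "\<not> m < d" using m that by (auto simp: R_def)
  moreover have "y \<le> m" if "\<not> m < d" using m y that by (simp add: E1_def)
  moreover have "real (Suc m) = M + 1" by (simp add: M_def)
  ultimately show ?thesis
    unfolding lhs R rate M_def[symmetric]
    by (auto simp: uniform_upto_def M_def[symmetric] rate add.commute[of 1 M])
qed

lemma ranked_dual_chain_E1:
  assumes d: "d > 1" and p: "0 < p" "real d * p \<le> 1"
  shows "ranked_dual_chain (E1 d) (P1 d p) (uniform_distribution (E1 d)) p {1..d} uniform_upto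
    (\<lambda>m. if m < d then {Suc m} else {}) (\<lambda>m. (real d - real m) * p) (\<lambda>m. d - m)"
proof
  show "real (d - m) * p \<le> 1" for m
    using order.trans[OF mult_right_mono[of "real (d - m)" "real d" p] p(2)] p(1) by simp
  show "uniform_upto m y = uniform_distribution (E1 d) y" if "m \<in> {1..d}" "d - m = 0" "y \<in> E1 d" for m y
    using that by (auto simp: uniform_upto_def uniform_distribution_def E1_def)
  show "evolve (E1 d) (P1 d p) (uniform_upto m) y =
      (\<Sum>j\<in>(if m < d then {Suc m} else {}). (real d - real m) * p * uniform_upto j y) +
      (1 - real (d - m) * p) * uniform_upto m y" if "m \<in> {1..d}" "y \<in> E1 d" for m y
    by (rule evolve_uniform_upto[OF d that])
qed (use p in \<open>auto simp: of_nat_diff uniform_upto_def split: if_split_asm\<close>)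


section \<open>The lazy walk on the cube\<close>

definition flip :: "nat \<Rightarrow> (nat \<Rightarrow> int) \<Rightarrow> nat \<Rightarrow> int" where
  "flip k x = x(k := 1 - x k)"

lemma E2_iff: "x \<in> E2 d \<longleftrightarrow> (\<forall>k\<in>{1..d}. x k = 0 \<or> x k = 1) \<and> (\<forall>k. k \<notin> {1..d} \<longrightarrow> x k = 0)"
  by (auto simp: E2_def PiE_dflt_def)

lemma finite_E2: "finite (E2 d)"
  unfolding E2_def by (rule finite_PiE_dflt) auto

lemma card_E2: "card (E2 d) = 2 ^ d"
  unfolding E2_def by (subst card_PiE_dflt) (auto simp: numeral_2_eq_2)

lemma flip_in_E2: "x \<in> E2 d \<Longrightarrow> k \<in> {1..d} \<Longrightarrow> flip k x \<in> E2 d"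
  by (auto simp: E2_iff flip_def)

lemma flip_flip: "flip k (flip k x) = x"
  by (auto simp: flip_def)

lemma flip_neq: "flip k x \<noteq> x"
proof
  assume "flip k x = x"
  then have "1 - x k = x k" by (metis flip_def fun_upd_same)
  then show False by presburger
qed

lemma flip_eq_iff: "flip k x = flip l x \<longleftrightarrow> k = l"
proof
  assume eq: "flip k x = flip l x"
  show "k = l"
  proof (rule ccontr)
    assume "k \<noteq> l"
    then have "1 - x k = x k" using fun_cong[OF eq, of k] by (simp add: flip_def)
    then show False by presburger
  qed
qed simp

text \<open>Inside the cube, adding or subtracting a unit vector is the same as flipping one coordinate, and
  different coordinates lead to different points. Written as a sum over coordinates, the kernel can be
  applied to functions without distinguishing cases.\<close>

lemma P2_flip:
  assumes "x \<in> E2 d" "y \<in> E2 d"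
  shows "P2 d p x y = (if x = y then 1 - 1/2 * real d * p else 0) +
    (\<Sum>k = 1..d. if x = flip k y then p / 2 else 0)"
proof -
  have step: "y = (\<lambda>j. x j + unit_vec k j) \<or> y = (\<lambda>j. x j - unit_vec k j) \<longleftrightarrow> x = flip k y"
    if k: "k \<in> {1..d}" for k
  proof
    assume "y = (\<lambda>j. x j + unit_vec k j) \<or> y = (\<lambda>j. x j - unit_vec k j)"
    then have "y k = x k + 1 \<or> y k = x k - 1" and "\<And>j. j \<noteq> k \<Longrightarrow> y j = x j"
      by (auto simp: unit_vec_def)
    moreover have "x k = 0 \<or> x k = 1" "y k = 0 \<or> y k = 1" using assms k by (auto simp: E2_iff)
    ultimately show "x = flip k y" by (auto simp: flip_def fun_eq_iff)
  next
    assume x: "x = flip k y"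
    have "y k = 0 \<or> y k = 1" using assms k by (auto simp: E2_iff)
    then show "y = (\<lambda>j. x j + unit_vec k j) \<or> y = (\<lambda>j. x j - unit_vec k j)"
      by (auto simp: x flip_def unit_vec_def fun_eq_iff)
  qed
  show ?thesis
  proof (cases "\<exists>k\<in>{1..d}. x = flip k y")
    case True
    then obtain k where k: "k \<in> {1..d}" "x = flip k y" by blast
    have "(\<Sum>l = 1..d. if x = flip l y then p / 2 else 0) = (\<Sum>l = 1..d. if l = k then p / 2 else 0)"
      by (rule sum.cong) (auto simp: k(2) flip_eq_iff)
    also have "\<dots> = p / 2" using k by simp
    finally have flips: "(\<Sum>l = 1..d. if x = flip l y then p / 2 else 0) = p / 2" .
    have "\<exists>k\<in>{1..d}. y = (\<lambda>j. x j + unit_vec k j) \<or> y = (\<lambda>j. x j - unit_vec k j)"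
      using step[OF k(1)] k by blast
    then have "P2 d p x y = p / 2" by (simp add: P2_def)
    then show ?thesis using flips flip_neq[of k y] by (simp add: k(2))
  next
    case False
    then have "\<not> (\<exists>k\<in>{1..d}. y = (\<lambda>j. x j + unit_vec k j) \<or> y = (\<lambda>j. x j - unit_vec k j))"
      using step by blast
    moreover have "(\<Sum>l = 1..d. if x = flip l y then p / 2 else 0) = 0"
      using False by (intro sum.neutral) auto
    ultimately show ?thesis by (auto simp: P2_def)
  qed
qed

lemma evolve_P2:
  assumes y: "y \<in> E2 d"
  shows "evolve (E2 d) (P2 d p) f y =
    (1 - 1/2 * real d * p) * f y + p / 2 * (\<Sum>k = 1..d. f (flip k y))"
proof -
  have "evolve (E2 d) (P2 d p) f y =
      (\<Sum>x\<in>E2 d. (if x = y then (1 - 1/2 * real d * p) * f x else 0) +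
        (\<Sum>k = 1..d. if x = flip k y then p / 2 * f x else 0))"
    unfolding evolve_def
  proof (rule sum.cong[OF refl])
    fix x assume x: "x \<in> E2 d"
    show "f x * P2 d p x y = (if x = y then (1 - 1/2 * real d * p) * f x else 0) +
        (\<Sum>k = 1..d. if x = flip k y then p / 2 * f x else 0)"
      unfolding P2_flip[OF x y] distrib_left sum_distrib_left
      by (intro arg_cong2[where f="(+)"] sum.cong) auto
  qed
  also have "\<dots> = (1 - 1/2 * real d * p) * f y +
      (\<Sum>k = 1..d. \<Sum>x\<in>E2 d. if x = flip k y then p / 2 * f x else 0)"
    using y finite_E2[of d] by (simp add: sum.distrib) (subst sum.swap, simp)
  also have "(\<Sum>k = 1..d. \<Sum>x\<in>E2 d. if x = flip k y then p / 2 * f x else 0) =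
      (\<Sum>k = 1..d. p / 2 * f (flip k y))"
    using flip_in_E2[OF y] finite_E2[of d] by (intro sum.cong) auto
  finally show ?thesis by (simp add: sum_distrib_left)
qed

lemma P2_symmetric:
  assumes "x \<in> E2 d" "y \<in> E2 d"
  shows "P2 d p x y = P2 d p y x"
proof -
  have "x = flip k y \<longleftrightarrow> y = flip k x" for k using flip_flip by metis
  then show ?thesis unfolding P2_flip[OF assms] P2_flip[OF assms(2,1)] by auto
qed

text \<open>By symmetry a row sum is a column sum, that is, the constant function evolved by one step.\<close>

lemma P2_row_sum:
  assumes "x \<in> E2 d"
  shows "(\<Sum>y\<in>E2 d. P2 d p x y) = 1"
proof -
  have "(\<Sum>y\<in>E2 d. P2 d p x y) = evolve (E2 d) (P2 d p) (\<lambda>_. 1) x"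
    unfolding evolve_def by (rule sum.cong) (use P2_symmetric assms in auto)
  then show ?thesis by (simp add: evolve_P2[OF assms])
qed

lemma P2_nonneg:
  assumes "0 < p" "real d * p \<le> 1"
  shows "0 \<le> P2 d p x y"
  using assms by (auto simp: P2_def)

text \<open>The law of a vector whose coordinates in \<open>S\<close> are fair coin tosses and whose other coordinates are
  \<open>0\<close>; it is meant for points of \<open>E2 d\<close>.\<close>

definition uniform_on_subcube :: "nat \<Rightarrow> nat set \<Rightarrow> (nat \<Rightarrow> int) \<Rightarrow> real" where
  "uniform_on_subcube d S x = (if \<forall>k\<in>{1..d} - S. x k = 0 then 1 / 2 ^ card S else 0)"

lemma uniform_on_subcube_flip_in:
  "k \<in> S \<Longrightarrow> uniform_on_subcube d S (flip k y) = uniform_on_subcube d S y"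
  by (auto simp: uniform_on_subcube_def flip_def)

text \<open>Averaging over the two values of coordinate \<open>k\<close> adds \<open>k\<close> to the set of random coordinates.\<close>

lemma uniform_on_subcube_refresh:
  assumes y: "y \<in> E2 d" and k: "k \<in> {1..d} - S" and S: "finite S"
  shows "uniform_on_subcube d S y + uniform_on_subcube d S (flip k y) =
    2 * uniform_on_subcube d (insert k S) y"
proof -
  have yk: "y k = 0 \<or> y k = 1" using y k by (auto simp: E2_iff)
  have card: "card (insert k S) = Suc (card S)" using k S by simp
  show ?thesis
  proof (cases "\<forall>j\<in>{1..d} - insert k S. y j = 0")
    case True
    then have "(\<forall>j\<in>{1..d} - S. y j = 0) \<longleftrightarrow> y k = 0"
        "(\<forall>j\<in>{1..d} - S. flip k y j = 0) \<longleftrightarrow> y k = 1"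
      using k by (auto simp: flip_def)
    with True yk show ?thesis by (auto simp: uniform_on_subcube_def card)
  next
    case False
    then have "\<not> (\<forall>j\<in>{1..d} - S. y j = 0)" "\<not> (\<forall>j\<in>{1..d} - S. flip k y j = 0)"
      by (auto simp: flip_def)
    with False show ?thesis by (simp add: uniform_on_subcube_def)
  qed
qed

text \<open>In \<open>(1 - dp/2) u + (p/2) \<Sum>\<^sub>k u(flip k y)\<close> a coordinate \<open>k \<in> S\<close> contributes \<open>u\<close> itself, and a
  coordinate \<open>k \<notin> S\<close> contributes \<open>2 u\<^bsub>S\<union>{k}\<^esub> - u\<close>. Collecting the multiples of \<open>u\<close> leaves
  \<open>1 - (d - |S|) p\<close>.\<close>

lemma evolve_uniform_on_subcube:
  assumes S: "S \<subseteq> {1..d}" and y: "y \<in> E2 d"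
  shows "evolve (E2 d) (P2 d p) (uniform_on_subcube d S) y =
    (\<Sum>S'\<in>(\<lambda>k. insert k S) ` ({1..d} - S). p * uniform_on_subcube d S' y) +
    (1 - real (d - card S) * p) * uniform_on_subcube d S y"
proof -
  let ?u = "uniform_on_subcube d"
  have fin: "finite S" using S finite_subset by blast
  have card_le: "card S \<le> d" using card_mono[OF _ S] by simp
  have card_diff: "card ({1..d} - S) = d - card S" using card_Diff_subset[OF fin S] by simp
  have inj: "inj_on (\<lambda>k. insert k S) ({1..d} - S)" by (auto simp: inj_on_def)
  have "(\<Sum>k = 1..d. ?u S (flip k y)) = (\<Sum>k\<in>{1..d} - S. ?u S (flip k y)) + (\<Sum>k\<in>S. ?u S (flip k y))"
    using S by (intro sum.subset_diff) auto
  also have "(\<Sum>k\<in>S. ?u S (flip k y)) = real (card S) * ?u S y"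
    by (simp add: uniform_on_subcube_flip_in)
  also have "(\<Sum>k\<in>{1..d} - S. ?u S (flip k y)) = (\<Sum>k\<in>{1..d} - S. 2 * ?u (insert k S) y - ?u S y)"
    using uniform_on_subcube_refresh[OF y _ fin] by (intro sum.cong) (auto simp: algebra_simps)
  also have "\<dots> = 2 * (\<Sum>k\<in>{1..d} - S. ?u (insert k S) y) - real (d - card S) * ?u S y"
    using card_diff by (simp add: sum_subtractf sum_distrib_left)
  finally have flips: "(\<Sum>k = 1..d. ?u S (flip k y)) =
      2 * (\<Sum>k\<in>{1..d} - S. ?u (insert k S) y) - real (d - card S) * ?u S y + real (card S) * ?u S y" .
  have "(\<Sum>S'\<in>(\<lambda>k. insert k S) ` ({1..d} - S). p * ?u S' y) = p * (\<Sum>k\<in>{1..d} - S. ?u (insert k S) y)"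
    unfolding sum.reindex[OF inj] sum_distrib_left by simp
  moreover have "real (d - card S) = real d - real (card S)" using card_le by simp
  ultimately show ?thesis
    unfolding evolve_P2[OF y] flips by (simp add: algebra_simps)
qed

lemma ranked_dual_chain_E2:
  assumes p: "0 < p" "real d * p \<le> 1"
  shows "ranked_dual_chain (E2 d) (P2 d p) (uniform_distribution (E2 d)) p {S. S \<subseteq> {1..d}}
    (uniform_on_subcube d) (\<lambda>S. (\<lambda>k. insert k S) ` ({1..d} - S)) (\<lambda>_. p) (\<lambda>S. d - card S)"
proof
  fix S assume "S \<in> {S. S \<subseteq> {1..d}}"
  then have S: "S \<subseteq> {1..d}" and fin: "finite S" using finite_subset by auto
  show "evolve (E2 d) (P2 d p) (uniform_on_subcube d S) y =
      (\<Sum>S'\<in>(\<lambda>k. insert k S) ` ({1..d} - S). p * uniform_on_subcube d S' y) +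
      (1 - real (d - card S) * p) * uniform_on_subcube d S y" if "y \<in> E2 d" for y
    by (rule evolve_uniform_on_subcube[OF S that])
  show "(\<lambda>k. insert k S) ` ({1..d} - S) \<subseteq> {S. S \<subseteq> {1..d}}" using S by auto
  show "d - card S' = d - card S - 1" if "S' \<in> (\<lambda>k. insert k S) ` ({1..d} - S)" for S'
    using that fin by auto
  have "inj_on (\<lambda>k. insert k S) ({1..d} - S)" by (auto simp: inj_on_def)
  then have "card ((\<lambda>k. insert k S) ` ({1..d} - S)) = d - card S"
    using card_Diff_subset[OF fin S] by (simp add: card_image)
  then show "real (card ((\<lambda>k. insert k S) ` ({1..d} - S))) * p = real (d - card S) * p" by simp
  show "real (d - card S) * p \<le> 1"
    using order.trans[OF mult_right_mono[of "real (d - card S)" "real d" p] p(2)] p(1) by simp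
  show "uniform_on_subcube d S y = uniform_distribution (E2 d) y" if "d - card S = 0" for y
  proof -
    have "S = {1..d}" using S that card_mono[OF _ S] by (intro card_subset_eq) auto
    then show ?thesis by (simp add: uniform_on_subcube_def uniform_distribution_def card_E2)
  qed
qed (use p in \<open>auto simp: uniform_on_subcube_def\<close>)


section \<open>The two fastest strong stationary times\<close>

theorem corollary4p18:
  fixes d :: nat and p :: real
  assumes "d > 1" and "0 < p" and "p \<le> 1 / real d"
  shows
    "stationary_distribution (E1 d) (P1 d p) (uniform_distribution (E1 d)) \<and>
     stationary_distribution (E2 d) (P2 d p) (uniform_distribution (E2 d)) \<and>
     (\<exists>(M :: ((nat \<Rightarrow> nat) \<times> nat) measure) F X T.
        fastest_strong_stationary_time (E1 d) \<nu>1 (P1 d p) (uniform_distribution (E1 d)) M F X T) \<and>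
     (\<exists>(M :: ((nat \<Rightarrow> nat \<Rightarrow> int) \<times> nat) measure) F X T.
        fastest_strong_stationary_time (E2 d) \<nu>2 (P2 d p) (uniform_distribution (E2 d)) M F X T) \<and>
     (\<forall>(M1 :: 'a measure) F1 X1 T1 (M2 :: 'b measure) F2 X2 T2 (N :: 'c measure) X.
        fastest_strong_stationary_time (E1 d) \<nu>1 (P1 d p) (uniform_distribution (E1 d)) M1 F1 X1 T1 \<and>
        fastest_strong_stationary_time (E2 d) \<nu>2 (P2 d p) (uniform_distribution (E2 d)) M2 F2 X2 T2 \<and>
        prob_space N \<and>
        prob_space.indep_vars N (\<lambda>_. count_space UNIV) X {1..d - 1} \<and>
        (\<forall>k\<in>{1..d - 1}. distr N (count_space UNIV) (X k) = measure_pmf (Geo (real k * p))) \<longrightarrow>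
        distr M1 (count_space UNIV) T1 = distr M2 (count_space UNIV) T2 \<and>
        distr M2 (count_space UNIV) T2 = distr N (count_space UNIV) (\<lambda>w. \<Sum>k = 1..d - 1. X k w))"
proof -
  let ?\<pi>1 = "uniform_distribution (E1 d)" and ?\<pi>2 = "uniform_distribution (E2 d)"
  have d: "d > 1" and p: "0 < p" and dp: "real d * p \<le> 1"
    using assms by (auto simp: field_simps)
  interpret C1: ranked_dual_chain "E1 d" "P1 d p" ?\<pi>1 p "{1..d}" uniform_upto
    "\<lambda>m. if m < d then {Suc m} else {}" "\<lambda>m. (real d - real m) * p" "\<lambda>m. d - m"
    by (rule ranked_dual_chain_E1[OF d p dp])
  interpret C2: ranked_dual_chain "E2 d" "P2 d p" ?\<pi>2 p "{S. S \<subseteq> {1..d}}" "uniform_on_subcube d"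
    "\<lambda>S. (\<lambda>k. insert k S) ` ({1..d} - S)" "\<lambda>_. p" "\<lambda>S. d - card S"
    by (rule ranked_dual_chain_E2[OF p dp])

  have fin1: "finite (E1 d)" by (simp add: E1_def)
  have stat1: "stationary_distribution (E1 d) (P1 d p) ?\<pi>1"
    by (rule C1.stationary_distribution_final[of d])
       (use d in \<open>auto simp: uniform_distribution_def E1_def\<close>)
  have start1: "\<nu>1 x = uniform_upto 1 x" if "x \<in> E1 d" for x
    using that by (auto simp: \<nu>1_def uniform_upto_def E1_def)
  have sum1: "(\<Sum>x\<in>E1 d. \<nu>1 x) = 1"
    using d by (simp add: \<nu>1_def E1_def)
  \<comment> \<open>State \<open>d\<close> lies outside every interval \<open>{1,\<dots>,m}\<close> with \<open>m < d\<close>.\<close>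
  have target1: "d \<in> E1 d" "0 < ?\<pi>1 d" using d by (auto simp: E1_def uniform_distribution_def)
  have miss1: "uniform_upto m d = 0" if "m \<in> {1..d}" "d - m \<noteq> 0" for m
    using that by (simp add: uniform_upto_def)
  have one: "1 \<in> {1..d}" using d by simp
  note fastest1 = C1.fastest_strong_stationary_time_dual[OF fin1 P1_nonneg[OF d p dp]
      P1_row_sum[OF d] stat1 p one start1 sum1 target1 miss1]

  have stat2: "stationary_distribution (E2 d) (P2 d p) ?\<pi>2"
    by (rule C2.stationary_distribution_final[of "{1..d}"])
       (auto simp: uniform_distribution_def card_E2)
  have start2: "\<nu>2 x = uniform_on_subcube d {1} x" if x: "x \<in> E2 d" for x
  proof -
    have "(\<forall>k\<in>{1..d} - {1}. x k = 0) \<longleftrightarrow> x = (\<lambda>_. 0) \<or> x = unit_vec 1"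
    proof
      assume "\<forall>k\<in>{1..d} - {1}. x k = 0"
      then have "x k = 0" if "k \<noteq> 1" for k using x that by (cases "k \<in> {1..d}") (auto simp: E2_iff)
      moreover have "x 1 = 0 \<or> x 1 = 1" using x d by (auto simp: E2_iff)
      ultimately show "x = (\<lambda>_. 0) \<or> x = unit_vec 1" unfolding unit_vec_def fun_eq_iff by metis
    qed (auto simp: unit_vec_def split: if_split_asm)
    then show ?thesis by (simp add: \<nu>2_def uniform_on_subcube_def)
  qed
  have sum2: "(\<Sum>x\<in>E2 d. \<nu>2 x) = 1"
  proof -
    have neq: "(\<lambda>_. 0) \<noteq> unit_vec 1" by (auto simp: unit_vec_def fun_eq_iff)
    have "(\<Sum>x\<in>E2 d. \<nu>2 x) = (\<Sum>x\<in>{\<lambda>_. 0, unit_vec 1}. \<nu>2 x)"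
      by (rule sum.mono_neutral_right)
         (use finite_E2 d in \<open>auto simp: \<nu>2_def E2_iff unit_vec_def\<close>)
    then show ?thesis using neq by (simp add: \<nu>2_def)
  qed
  \<comment> \<open>Any \<open>u\<^sub>S\<close> with \<open>S\<close> a proper subset vanishes at the all-ones vector.\<close>
  define z where "z j = (if j \<in> {1..d} then 1 else 0 :: int)" for j
  have target2: "z \<in> E2 d" "0 < ?\<pi>2 z" by (auto simp: E2_iff z_def uniform_distribution_def card_E2)
  have miss2: "uniform_on_subcube d S z = 0" if "S \<in> {S. S \<subseteq> {1..d}}" "d - card S \<noteq> 0" for S
  proof -
    have "S \<noteq> {1..d}" using that by auto
    then have "\<exists>k\<in>{1..d} - S. z k \<noteq> 0" using that by (auto simp: z_def)
    then show ?thesis by (auto simp: uniform_on_subcube_def)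
  qed
  have one_set: "{1} \<in> {S. S \<subseteq> {1..d}}" using d by simp
  note fastest2 = C2.fastest_strong_stationary_time_dual[OF finite_E2 P2_nonneg[OF p dp]
      P2_row_sum stat2 p one_set start2 sum2 target2 miss2]

  have laws: "distr M1 (count_space UNIV) T1 = distr M2 (count_space UNIV) T2 \<and>
      distr M2 (count_space UNIV) T2 = distr N (count_space UNIV) (\<lambda>w. \<Sum>k = 1..d - 1. X k w)"
    if f1: "fastest_strong_stationary_time (E1 d) \<nu>1 (P1 d p) ?\<pi>1 M1 F1 X1 T1"
      and f2: "fastest_strong_stationary_time (E2 d) \<nu>2 (P2 d p) ?\<pi>2 M2 F2 X2 T2"
      and N: "prob_space N" and indep: "prob_space.indep_vars N (\<lambda>_. count_space UNIV) X {1..d - 1}"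
      and X: "\<forall>k\<in>{1..d - 1}. distr N (count_space UNIV) (X k) = measure_pmf (Geo (real k * p))"
    for M1 :: "'a measure" and F1 X1 T1 and M2 :: "'b measure" and F2 X2 T2
      and N :: "'c measure" and X
  proof
    have s1: "strong_stationary_time (E1 d) \<nu>1 (P1 d p) ?\<pi>1 M1 F1 X1 T1"
      and s2: "strong_stationary_time (E2 d) \<nu>2 (P2 d p) ?\<pi>2 M2 F2 X2 T2"
      using f1 f2 by (auto simp: fastest_strong_stationary_time_def)
    have ps: "prob_space M1" "prob_space M2"
      using s1 s2 by (auto simp: strong_stationary_time_def markov_chain_def)
    note T = strong_stationary_time_measurable[OF s1] strong_stationary_time_measurable[OF s2]
    have rv: "X k \<in> borel_measurable N" if "k \<in> {1..d - 1}" for k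
      using indep that measurable_cong_sets[OF refl sets_borel_eq_count_space]
      unfolding prob_space.indep_vars_def2[OF N] by blast
    have S: "(\<lambda>w. \<Sum>k = 1..d - 1. X k w) \<in> measurable N (count_space UNIV)"
      using borel_measurable_sum[of "{1..d - 1}" X N] rv
        measurable_cong_sets[OF refl sets_borel_eq_count_space] by blast
    have "real (d - 1) * p \<le> 1"
      using order.trans[OF mult_right_mono[of "real (d - 1)" "real d" p] dp] p by simp
    then have law_N: "measure N {w \<in> space N. (\<Sum>k = 1..d - 1. X k w) \<le> n} = geo_sum_cdf p (d - 1) n" for n
      using X by (intro measure_sum_Geo_le[OF N indep _ p]) auto
    have law1: "measure M1 {w \<in> space M1. T1 w \<le> n} = geo_sum_cdf p (d - 1) n" for n
      by (rule fastest1(2)[OF _ _ _ _ _ _ f1])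
    have law2: "measure M2 {w \<in> space M2. T2 w \<le> n} = geo_sum_cdf p (d - 1) n" for n
      using fastest2(2)[OF _ _ _ _ f2] by simp
    show "distr M1 (count_space UNIV) T1 = distr M2 (count_space UNIV) T2"
      by (rule distr_nat_eqI[OF ps T]) (simp only: law1 law2)
    show "distr M2 (count_space UNIV) T2 = distr N (count_space UNIV) (\<lambda>w. \<Sum>k = 1..d - 1. X k w)"
      by (rule distr_nat_eqI[OF ps(2) N T(2) S]) (simp only: law2 law_N)
  qed
  have "\<exists>(M :: ((nat \<Rightarrow> nat) \<times> nat) measure) F X T.
      fastest_strong_stationary_time (E1 d) \<nu>1 (P1 d p) ?\<pi>1 M F X T"
    by (rule fastest1(1))
  moreover have "\<exists>(M :: ((nat \<Rightarrow> nat \<Rightarrow> int) \<times> nat) measure) F X T.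
      fastest_strong_stationary_time (E2 d) \<nu>2 (P2 d p) ?\<pi>2 M F X T"
    by (rule fastest2(1))
  ultimately show ?thesis using stat1 stat2 laws by blast
qed

end
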